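(* Let $R$ be a ring and $M$ a non-zero left $R$-module. The following statements are equivalent: (a) $M$ is homogeneous semisimple. (b) Each non-zero module in $\sigma[M]$ is endo-prime. (c) Each non-zero module in $\sigma[M]$ is endo-coprime. (d) Each non-zero module in $\sigma[M]$ is endo-simple.
   Context: Rings are associative with non-zero identity and modules are unital. $\sigma[M]$ is the full subcategory of left $R$-modules subgenerated by $M$, i.e. modules isomorphic to submodules of $M$-generated modules (homomorphic images of direct sums of copies of $M$). Homogeneous semisimple means being a direct sum of mutually isomorphic simple modules. For a non-zero module $N$ with $S=\mathrm{End}_R(N)$, a submodule $K$ is fully invariant if every $f\in S$ maps $K$ into $K$. $N$ is endo-prime if for every non-zero fully invariant submodule $K$ the only $f\in S$ vanishing on $K$ is $0$; endo-coprime if for every proper fully invariant submodule $K$ the only $f\in S$ with $f(N)\subseteq K$ is $0$; endo-simple if its only fully invariant submodules are $0$ and $N$. *)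

theory Defs
  imports "HOL-Algebra.Module" "HOL-Algebra.Product_Groups"
begin

(* The library locale module requires a commutative ring of scalars; this is the same list of
   axioms over an arbitrary ring. As there, the fields mult and one of the record M play no role.
   The library locale submodule does not mention commutativity and is used as it is. *)
locale left_module = R?: ring R + M?: abelian_group M
  for R :: "('r, 'x) ring_scheme" (structure) and M :: "('r, 'm) module" (structure) +
  assumes smult_closed:
      "\<lbrakk>a \<in> carrier R; x \<in> carrier M\<rbrakk> \<Longrightarrow> a \<odot>\<^bsub>M\<^esub> x \<in> carrier M"
    and smult_l_distr:
      "\<lbrakk>a \<in> carrier R; b \<in> carrier R; x \<in> carrier M\<rbrakk> \<Longrightarrow>
        (a \<oplus>\<^bsub>R\<^esub> b) \<odot>\<^bsub>M\<^esub> x = a \<odot>\<^bsub>M\<^esub> x \<oplus>\<^bsub>M\<^esub> b \<odot>\<^bsub>M\<^esub> x"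
    and smult_r_distr:
      "\<lbrakk>a \<in> carrier R; x \<in> carrier M; y \<in> carrier M\<rbrakk> \<Longrightarrow>
        a \<odot>\<^bsub>M\<^esub> (x \<oplus>\<^bsub>M\<^esub> y) = a \<odot>\<^bsub>M\<^esub> x \<oplus>\<^bsub>M\<^esub> a \<odot>\<^bsub>M\<^esub> y"
    and smult_assoc:
      "\<lbrakk>a \<in> carrier R; b \<in> carrier R; x \<in> carrier M\<rbrakk> \<Longrightarrow>
        (a \<otimes>\<^bsub>R\<^esub> b) \<odot>\<^bsub>M\<^esub> x = a \<odot>\<^bsub>M\<^esub> (b \<odot>\<^bsub>M\<^esub> x)"
    and smult_one: "x \<in> carrier M \<Longrightarrow> \<one>\<^bsub>R\<^esub> \<odot>\<^bsub>M\<^esub> x = x"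

definition nonzero_module :: "('r, 'm) module \<Rightarrow> bool"
  where "nonzero_module M \<longleftrightarrow> carrier M \<noteq> {\<zero>\<^bsub>M\<^esub>}"

definition mod_hom ::
    "('r, 'x) ring_scheme \<Rightarrow> ('r, 'm) module \<Rightarrow> ('r, 'n) module \<Rightarrow> ('m \<Rightarrow> 'n) set"
  where "mod_hom R M N =
    {f \<in> hom (add_monoid M) (add_monoid N).
       \<forall>a\<in>carrier R. \<forall>x\<in>carrier M. f (a \<odot>\<^bsub>M\<^esub> x) = a \<odot>\<^bsub>N\<^esub> f x}"

definition mod_isomorphic ::
    "('r, 'x) ring_scheme \<Rightarrow> ('r, 'm) module \<Rightarrow> ('r, 'n) module \<Rightarrow> bool"
  where "mod_isomorphic R M N \<longleftrightarrow> (\<exists>f\<in>mod_hom R M N. bij_betw f (carrier M) (carrier N))"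

definition direct_sum :: "'i set \<Rightarrow> ('i \<Rightarrow> ('r, 'm) module) \<Rightarrow> ('r, 'i \<Rightarrow> 'm) module"
  where "direct_sum I S =
    \<lparr>carrier = carrier (sum_group I (\<lambda>i. add_monoid (S i))),
     monoid.mult = undefined, one = undefined,
     zero = one (sum_group I (\<lambda>i. add_monoid (S i))),
     add = monoid.mult (sum_group I (\<lambda>i. add_monoid (S i))),
     smult = (\<lambda>a x. \<lambda>i\<in>I. a \<odot>\<^bsub>S i\<^esub> x i)\<rparr>"

definition simple_module :: "('r, 'x) ring_scheme \<Rightarrow> ('r, 'm) module \<Rightarrow> bool"
  where "simple_module R M \<longleftrightarrow> left_module R M \<and> nonzero_module M \<and>
    (\<forall>K. submodule K R M \<longrightarrow> K = {\<zero>\<^bsub>M\<^esub>} \<or> K = carrier M)"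

(* Drawing the index set and the carriers of the summands from 'm is no restriction: each summand
   embeds in M, and choosing a non-zero element of each summand embeds the index set in M. *)
definition homogeneous_semisimple :: "('r, 'x) ring_scheme \<Rightarrow> ('r, 'm) module \<Rightarrow> bool"
  where "homogeneous_semisimple R M \<longleftrightarrow>
    (\<exists>(I :: 'm set) (S :: 'm \<Rightarrow> ('r, 'm) module).
       (\<forall>i\<in>I. simple_module R (S i)) \<and>
       (\<forall>i\<in>I. \<forall>j\<in>I. mod_isomorphic R (S i) (S j)) \<and>
       mod_isomorphic R M (direct_sum I S))"

(* The type 'u serves as a universe: the index sets of the direct sums and the carriers of all
   modules in sigma R M are subsets of 'u. If 'u is infinite and carrier M embeds in 'u, then every
   module with carrier in 'u that is subgenerated by M at all belongs to sigma R M: it embeds in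
   a quotient of the direct sum of at most |'u| copies of M, which has at most |'u| elements. *)
definition is_generated_by ::
    "('r, 'x) ring_scheme \<Rightarrow> ('r, 'm) module \<Rightarrow> ('r, 'u) module \<Rightarrow> bool"
  where "is_generated_by R M G \<longleftrightarrow> left_module R G \<and>
    (\<exists>I :: 'u set. \<exists>f\<in>mod_hom R (direct_sum I (\<lambda>_. M)) G.
       f ` carrier (direct_sum I (\<lambda>_. M)) = carrier G)"

definition sigma :: "('r, 'x) ring_scheme \<Rightarrow> ('r, 'm) module \<Rightarrow> ('r, 'u) module set"
  where "sigma R M = {N. left_module R N \<and>
    (\<exists>(G :: ('r, 'u) module) H. is_generated_by R M G \<and> submodule H R G \<and>
       mod_isomorphic R N (G\<lparr>carrier := H\<rparr>))}"

definition fully_invariant :: "('r, 'x) ring_scheme \<Rightarrow> ('r, 'n) module \<Rightarrow> 'n set \<Rightarrow> bool"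
  where "fully_invariant R N K \<longleftrightarrow> submodule K R N \<and> (\<forall>f\<in>mod_hom R N N. f ` K \<subseteq> K)"

(* Homomorphisms are HOL functions that are unconstrained outside the carrier, so f is the zero
   homomorphism iff it vanishes on the carrier. *)
definition endo_prime :: "('r, 'x) ring_scheme \<Rightarrow> ('r, 'n) module \<Rightarrow> bool"
  where "endo_prime R N \<longleftrightarrow>
    (\<forall>K. fully_invariant R N K \<and> K \<noteq> {\<zero>\<^bsub>N\<^esub>} \<longrightarrow>
      (\<forall>f\<in>mod_hom R N N. (\<forall>x\<in>K. f x = \<zero>\<^bsub>N\<^esub>) \<longrightarrow> (\<forall>x\<in>carrier N. f x = \<zero>\<^bsub>N\<^esub>)))"

definition endo_coprime :: "('r, 'x) ring_scheme \<Rightarrow> ('r, 'n) module \<Rightarrow> bool"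
  where "endo_coprime R N \<longleftrightarrow>
    (\<forall>K. fully_invariant R N K \<and> K \<noteq> carrier N \<longrightarrow>
      (\<forall>f\<in>mod_hom R N N. f ` carrier N \<subseteq> K \<longrightarrow> (\<forall>x\<in>carrier N. f x = \<zero>\<^bsub>N\<^esub>)))"

definition endo_simple :: "('r, 'x) ring_scheme \<Rightarrow> ('r, 'n) module \<Rightarrow> bool"
  where "endo_simple R N \<longleftrightarrow>
    (\<forall>K. fully_invariant R N K \<longrightarrow> K = {\<zero>\<^bsub>N\<^esub>} \<or> K = carrier N)"

end

theory Submission
  imports Defs
begin

text \<open>Everything is expressed through the trace of a simple module \<open>S\<close> in a module \<open>N\<close>, the sum of
all homomorphic images of \<open>S\<close> in \<open>N\<close>. A non-zero module is homogeneous semisimple iff it equals the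
trace in it of some simple module.

Suppose that \<open>M\<close> equals the trace of \<open>S\<close> in \<open>M\<close>. This property passes from \<open>M\<close> to direct sums of copies of \<open>M\<close>,
to homomorphic images, and, because every submodule of such a module is a direct summand
(\<open>submodule_retraction\<close>), to submodules. Hence each \<open>N\<close> in \<open>\<sigma>[M]\<close> has it. A non-zero fully invariant
submodule of \<open>N\<close> then contains a copy of \<open>S\<close>. This copy is a direct summand of \<open>N\<close>, so endomorphisms
of \<open>N\<close> map it onto every other copy of \<open>S\<close>, and the submodule is all of \<open>N\<close>. So \<open>N\<close> is endo-simple
(\<open>endo_simple_if_generated_by_simple\<close>), which trivially implies endo-prime and endo-coprime.

For the converse, \<open>M\<close> has a simple subquotient \<open>S\<close>. Let \<open>T\<close> be the trace of \<open>S\<close> in \<open>M\<close>. The module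
\<open>L = M \<oplus> S \<oplus> M/T\<close> belongs to \<open>\<sigma>[M]\<close>, being a submodule of a quotient of \<open>M \<oplus> M \<oplus> M\<close>
(\<open>sigma_contains_test_module\<close>), and one of its endomorphisms shows \<open>M = T\<close> in either case. Let \<open>K\<close>
be the trace of \<open>S\<close> in \<open>L\<close>, a non-zero fully invariant submodule. The endomorphism \<open>M \<rightarrow> M/T\<close> of \<open>L\<close>
vanishes on \<open>K\<close>, so if \<open>L\<close> is endo-prime, then \<open>M/T = 0\<close>. The projection of \<open>L\<close> to \<open>S\<close> is non-zero with
image in \<open>K\<close>, so if \<open>L\<close> is endo-coprime, then \<open>K = L\<close>, and projecting to \<open>M\<close> gives \<open>M = T\<close>.\<close>

section \<open>Submodules and homomorphisms\<close>

context left_module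
begin

lemma smult_l_null: "x \<in> carrier M \<Longrightarrow> \<zero>\<^bsub>R\<^esub> \<odot>\<^bsub>M\<^esub> x = \<zero>\<^bsub>M\<^esub>"
  by (metis M.add.r_cancel_one' R.l_zero R.zero_closed smult_closed smult_l_distr)

lemma smult_r_null: "a \<in> carrier R \<Longrightarrow> a \<odot>\<^bsub>M\<^esub> \<zero>\<^bsub>M\<^esub> = \<zero>\<^bsub>M\<^esub>"
  by (metis M.add.r_cancel_one' M.l_zero M.zero_closed smult_closed smult_r_distr)

lemma smult_minus_one:
  assumes "x \<in> carrier M"
  shows "(\<ominus>\<^bsub>R\<^esub> \<one>\<^bsub>R\<^esub>) \<odot>\<^bsub>M\<^esub> x = \<ominus>\<^bsub>M\<^esub> x"
proof -
  have "(\<ominus>\<^bsub>R\<^esub> \<one>\<^bsub>R\<^esub>) \<odot>\<^bsub>M\<^esub> x \<oplus>\<^bsub>M\<^esub> x = (\<ominus>\<^bsub>R\<^esub> \<one>\<^bsub>R\<^esub> \<oplus>\<^bsub>R\<^esub> \<one>\<^bsub>R\<^esub>) \<odot>\<^bsub>M\<^esub> x"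
    using assms smult_l_distr[of "\<ominus>\<^bsub>R\<^esub> \<one>\<^bsub>R\<^esub>" "\<one>\<^bsub>R\<^esub>" x] by (simp add: smult_one)
  also have "\<dots> = \<zero>\<^bsub>M\<^esub>"
    using assms by (simp add: R.l_neg smult_l_null)
  finally show ?thesis
    using assms smult_closed[of "\<ominus>\<^bsub>R\<^esub> \<one>\<^bsub>R\<^esub>" x] M.minus_equality[of _ x] by simp
qed

lemma submoduleI:
  assumes "H \<subseteq> carrier M" "\<zero>\<^bsub>M\<^esub> \<in> H"
    and "\<And>x y. x \<in> H \<Longrightarrow> y \<in> H \<Longrightarrow> x \<oplus>\<^bsub>M\<^esub> y \<in> H"
    and "\<And>a x. a \<in> carrier R \<Longrightarrow> x \<in> H \<Longrightarrow> a \<odot>\<^bsub>M\<^esub> x \<in> H"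
  shows "submodule H R M"
proof -
  have "\<ominus>\<^bsub>M\<^esub> x \<in> H" if "x \<in> H" for x
    using assms(4)[of "\<ominus>\<^bsub>R\<^esub> \<one>\<^bsub>R\<^esub>" x] smult_minus_one[of x] that assms(1) by auto
  then show ?thesis
    using assms
    by (intro submodule.intro subgroup.intro submodule_axioms.intro) (auto simp: a_inv_def)
qed

lemma submoduleD:
  assumes "submodule H R M"
  shows "H \<subseteq> carrier M" and "\<zero>\<^bsub>M\<^esub> \<in> H"
    and "\<And>x y. x \<in> H \<Longrightarrow> y \<in> H \<Longrightarrow> x \<oplus>\<^bsub>M\<^esub> y \<in> H"
    and "\<And>x. x \<in> H \<Longrightarrow> \<ominus>\<^bsub>M\<^esub> x \<in> H"
    and "\<And>a x. a \<in> carrier R \<Longrightarrow> x \<in> H \<Longrightarrow> a \<odot>\<^bsub>M\<^esub> x \<in> H"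
proof -
  have sg: "subgroup H (add_monoid M)"
    using assms by (simp add: submodule_def)
  show "H \<subseteq> carrier M" "\<zero>\<^bsub>M\<^esub> \<in> H"
    "\<And>x y. x \<in> H \<Longrightarrow> y \<in> H \<Longrightarrow> x \<oplus>\<^bsub>M\<^esub> y \<in> H"
    "\<And>x. x \<in> H \<Longrightarrow> \<ominus>\<^bsub>M\<^esub> x \<in> H"
    using subgroup.subset[OF sg] subgroup.one_closed[OF sg] subgroup.m_closed[OF sg]
      subgroup.m_inv_closed[OF sg]
    by (auto simp: a_inv_def)
  show "\<And>a x. a \<in> carrier R \<Longrightarrow> x \<in> H \<Longrightarrow> a \<odot>\<^bsub>M\<^esub> x \<in> H"
    using submodule.smult_closed[OF assms] .
qed

lemma submodule_is_left_module:
  assumes "submodule H R M"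
  shows "left_module R (M\<lparr>carrier := H\<rparr>)"
proof -
  note H = submoduleD[OF assms]
  have "abelian_group (M\<lparr>carrier := H\<rparr>)"
  proof (rule abelian_groupI, goal_cases)
    case (3 x y z) then show ?case using H(1) by (auto intro!: M.a_assoc)
  next
    case (4 x y) then show ?case using H(1) by (auto intro!: M.a_comm)
  next
    case (6 x) then show ?case using H(1) M.l_neg[of x] H(4)[of x] by auto
  qed (use H in auto)
  then show ?thesis
    using H by (intro left_module.intro left_module_axioms.intro R.ring_axioms)
      (auto simp: smult_one smult_assoc smult_l_distr smult_r_distr subset_eq)
qed

lemma carrier_submodule: "submodule (carrier M) R M"
  by (intro submoduleI) (auto intro: smult_closed)

lemma zero_submodule: "submodule {\<zero>\<^bsub>M\<^esub>} R M"
  by (intro submoduleI) (auto simp: smult_r_null)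

lemma cyclic_submodule:
  assumes "x \<in> carrier M"
  shows "submodule ((\<lambda>a. a \<odot>\<^bsub>M\<^esub> x) ` carrier R) R M"
proof (rule submoduleI)
  show "\<zero>\<^bsub>M\<^esub> \<in> (\<lambda>a. a \<odot>\<^bsub>M\<^esub> x) ` carrier R"
    using assms by (auto simp: smult_l_null intro!: rev_image_eqI[of "\<zero>\<^bsub>R\<^esub>"])
  show "y \<oplus>\<^bsub>M\<^esub> z \<in> (\<lambda>a. a \<odot>\<^bsub>M\<^esub> x) ` carrier R"
    if "y \<in> (\<lambda>a. a \<odot>\<^bsub>M\<^esub> x) ` carrier R" "z \<in> (\<lambda>a. a \<odot>\<^bsub>M\<^esub> x) ` carrier R" for y z
    using that assms by (auto simp: smult_l_distr[symmetric])
  show "a \<odot>\<^bsub>M\<^esub> y \<in> (\<lambda>a. a \<odot>\<^bsub>M\<^esub> x) ` carrier R"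
    if "a \<in> carrier R" "y \<in> (\<lambda>a. a \<odot>\<^bsub>M\<^esub> x) ` carrier R" for a y
    using that assms by (auto simp: smult_assoc[symmetric])
qed (use assms in \<open>auto intro: smult_closed\<close>)

lemma minus_eq_zero_iff:
  assumes "x \<in> carrier M" "y \<in> carrier M"
  shows "x \<ominus>\<^bsub>M\<^esub> y = \<zero>\<^bsub>M\<^esub> \<longleftrightarrow> x = y"
  using assms M.minus_equality[of x "\<ominus>\<^bsub>M\<^esub> y"]
  by (auto simp: M.minus_eq M.r_neg)

end

lemma (in left_module) Int_submodule:
  assumes "submodule H R M" "submodule K R M"
  shows "submodule (H \<inter> K) R M"
  using submoduleD[OF assms(1)] submoduleD[OF assms(2)] by (intro submoduleI) auto

lemma (in left_module) sum_submodule: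
  assumes "submodule H R M" "submodule K R M"
  shows "submodule {u \<oplus>\<^bsub>M\<^esub> v |u v. u \<in> H \<and> v \<in> K} R M" (is "submodule ?D R M")
proof -
  note H = submoduleD[OF assms(1)] and K = submoduleD[OF assms(2)]
  show ?thesis
  proof (rule submoduleI)
    show "?D \<subseteq> carrier M" using H(1) K(1) by auto
    show "\<zero>\<^bsub>M\<^esub> \<in> ?D" using H(2) K(2) M.l_zero[OF M.zero_closed] by force
    show "x \<oplus>\<^bsub>M\<^esub> y \<in> ?D" if "x \<in> ?D" "y \<in> ?D" for x y
    proof -
      obtain u v u' v' where uv: "u \<in> H" "v \<in> K" "x = u \<oplus>\<^bsub>M\<^esub> v" "u' \<in> H" "v' \<in> K" "y = u' \<oplus>\<^bsub>M\<^esub> v'"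
        using \<open>x \<in> ?D\<close> \<open>y \<in> ?D\<close> by blast
      then have "x \<oplus>\<^bsub>M\<^esub> y = (u \<oplus>\<^bsub>M\<^esub> u') \<oplus>\<^bsub>M\<^esub> (v \<oplus>\<^bsub>M\<^esub> v')"
        using H(1) K(1) by (simp add: subset_eq M.add.m_ac)
      then show ?thesis using uv H(3) K(3) by blast
    qed
    show "a \<odot>\<^bsub>M\<^esub> x \<in> ?D" if a: "a \<in> carrier R" and "x \<in> ?D" for a x
    proof -
      obtain u v where uv: "u \<in> H" "v \<in> K" "x = u \<oplus>\<^bsub>M\<^esub> v"
        using \<open>x \<in> ?D\<close> by blast
      then have "a \<odot>\<^bsub>M\<^esub> x = a \<odot>\<^bsub>M\<^esub> u \<oplus>\<^bsub>M\<^esub> a \<odot>\<^bsub>M\<^esub> v"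
        using H(1) K(1) a by (auto simp: subset_eq smult_r_distr)
      then show ?thesis using uv a H(5) K(5) by blast
    qed
  qed
qed

lemma (in left_module) submodule_add_cancel:
  assumes "submodule K R M" "x \<in> carrier M" "y \<in> K" "x \<oplus>\<^bsub>M\<^esub> y \<in> K"
  shows "x \<in> K"
proof -
  note K = submoduleD[OF assms(1)]
  have "x = (x \<oplus>\<^bsub>M\<^esub> y) \<oplus>\<^bsub>M\<^esub> \<ominus>\<^bsub>M\<^esub> y"
    using assms K(1) by (simp add: subset_eq M.a_assoc M.r_neg)
  then show ?thesis using K(3)[OF assms(4) K(4)[OF assms(3)]] by simp
qed

lemma mod_homI:
  assumes "\<And>x. x \<in> carrier A \<Longrightarrow> f x \<in> carrier B"
    and "\<And>x y. x \<in> carrier A \<Longrightarrow> y \<in> carrier A \<Longrightarrow> f (x \<oplus>\<^bsub>A\<^esub> y) = f x \<oplus>\<^bsub>B\<^esub> f y"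
    and "\<And>a x. a \<in> carrier R \<Longrightarrow> x \<in> carrier A \<Longrightarrow> f (a \<odot>\<^bsub>A\<^esub> x) = a \<odot>\<^bsub>B\<^esub> f x"
  shows "f \<in> mod_hom R A B"
  using assms by (auto simp: mod_hom_def hom_def)

lemma mod_homD:
  assumes "f \<in> mod_hom R A B"
  shows "\<And>x. x \<in> carrier A \<Longrightarrow> f x \<in> carrier B"
    and "\<And>x y. x \<in> carrier A \<Longrightarrow> y \<in> carrier A \<Longrightarrow> f (x \<oplus>\<^bsub>A\<^esub> y) = f x \<oplus>\<^bsub>B\<^esub> f y"
    and "\<And>a x. a \<in> carrier R \<Longrightarrow> x \<in> carrier A \<Longrightarrow> f (a \<odot>\<^bsub>A\<^esub> x) = a \<odot>\<^bsub>B\<^esub> f x"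
  using assms by (auto simp: mod_hom_def hom_def)

lemma mod_hom_zero:
  assumes "left_module R A" "left_module R B" "f \<in> mod_hom R A B"
  shows "f \<zero>\<^bsub>A\<^esub> = \<zero>\<^bsub>B\<^esub>"
proof -
  interpret A: left_module R A by fact
  interpret B: left_module R B by fact
  show ?thesis
    using mod_homD(3)[OF assms(3), of "\<zero>\<^bsub>R\<^esub>" "\<zero>\<^bsub>A\<^esub>"] mod_homD(1)[OF assms(3), of "\<zero>\<^bsub>A\<^esub>"]
    by (simp add: A.smult_l_null B.smult_l_null)
qed

lemma mod_hom_minus:
  assumes "left_module R A" "left_module R B" "f \<in> mod_hom R A B"
    and "x \<in> carrier A" "y \<in> carrier A"
  shows "f (x \<ominus>\<^bsub>A\<^esub> y) = f x \<ominus>\<^bsub>B\<^esub> f y"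
proof -
  interpret A: left_module R A by fact
  interpret B: left_module R B by fact
  note f = mod_homD[OF assms(3)]
  show ?thesis
    using assms(4,5) f(1)[of y]
    by (simp add: A.M.minus_eq B.M.minus_eq f A.smult_minus_one[symmetric]
        B.smult_minus_one[symmetric] A.smult_closed)
qed

lemma mod_hom_eq_iff:
  assumes "left_module R A" "left_module R B" "f \<in> mod_hom R A B"
    and "x \<in> carrier A" "y \<in> carrier A"
  shows "f x = f y \<longleftrightarrow> f (x \<ominus>\<^bsub>A\<^esub> y) = \<zero>\<^bsub>B\<^esub>"
  using left_module.minus_eq_zero_iff[OF assms(2), of "f x" "f y"] mod_homD(1)[OF assms(3)]
    mod_hom_minus[OF assms] assms(4,5) by simp

lemma mod_hom_inj_onI:
  assumes "left_module R A" "left_module R B" "f \<in> mod_hom R A B"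
    and ker: "\<And>x. x \<in> carrier A \<Longrightarrow> f x = \<zero>\<^bsub>B\<^esub> \<Longrightarrow> x = \<zero>\<^bsub>A\<^esub>"
  shows "inj_on f (carrier A)"
proof (rule inj_onI)
  interpret A: left_module R A by fact
  fix x y assume xy: "x \<in> carrier A" "y \<in> carrier A" "f x = f y"
  then have "f (x \<ominus>\<^bsub>A\<^esub> y) = \<zero>\<^bsub>B\<^esub>"
    using mod_hom_eq_iff[OF assms(1-3)] by blast
  then have "x \<ominus>\<^bsub>A\<^esub> y = \<zero>\<^bsub>A\<^esub>"
    using ker xy by simp
  then show "x = y"
    using xy A.minus_eq_zero_iff by blast
qed

lemma mod_hom_comp:
  "f \<in> mod_hom R A B \<Longrightarrow> g \<in> mod_hom R B C \<Longrightarrow> (\<lambda>x. g (f x)) \<in> mod_hom R A C"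
  by (intro mod_homI) (auto simp: mod_homD)

lemma mod_hom_id: "(\<lambda>x. x) \<in> mod_hom R A A"
  by (auto simp: mod_hom_def hom_def)

lemma mod_hom_inclusion: "H \<subseteq> carrier A \<Longrightarrow> (\<lambda>x. x) \<in> mod_hom R (A\<lparr>carrier := H\<rparr>) A"
  by (auto simp: mod_hom_def hom_def)

lemma mod_hom_restrict_dom:
  "f \<in> mod_hom R A B \<Longrightarrow> H \<subseteq> carrier A \<Longrightarrow> f \<in> mod_hom R (A\<lparr>carrier := H\<rparr>) B"
  by (intro mod_homI) (auto simp: mod_homD subset_eq)

lemma mod_hom_restrict_cod:
  "f \<in> mod_hom R A B \<Longrightarrow> f ` carrier A \<subseteq> H \<Longrightarrow> f \<in> mod_hom R A (B\<lparr>carrier := H\<rparr>)"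
  by (auto simp: mod_hom_def hom_def)

lemma vimage_submodule:
  assumes "left_module R A" "left_module R B" "f \<in> mod_hom R A B" "submodule K R B"
  shows "submodule {x \<in> carrier A. f x \<in> K} R A"
proof -
  interpret A: left_module R A by fact
  interpret B: left_module R B by fact
  note K = B.submoduleD[OF assms(4)] and f = mod_homD[OF assms(3)]
  show ?thesis
    using mod_hom_zero[OF assms(1-3)]
    by (intro A.submoduleI) (auto simp: f K A.smult_closed)
qed

lemma image_submodule:
  assumes "left_module R A" "left_module R B" "f \<in> mod_hom R A B" "submodule K R A"
  shows "submodule (f ` K) R B"
proof -
  interpret A: left_module R A by fact
  interpret B: left_module R B by fact
  note K = A.submoduleD[OF assms(4)] and f = mod_homD[OF assms(3)]
  have K': "x \<in> carrier A" if "x \<in> K" for x using K(1) that by blast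
  show ?thesis
  proof (rule B.submoduleI)
    show "\<zero>\<^bsub>B\<^esub> \<in> f ` K"
      using mod_hom_zero[OF assms(1-3)] K(2) by (metis image_eqI)
    show "x \<oplus>\<^bsub>B\<^esub> y \<in> f ` K" if "x \<in> f ` K" "y \<in> f ` K" for x y
      using that by (auto simp: f(2)[symmetric] K' intro!: imageI K(3))
    show "a \<odot>\<^bsub>B\<^esub> x \<in> f ` K" if "a \<in> carrier R" "x \<in> f ` K" for a x
      using that by (auto simp: f(3)[symmetric] K' intro!: imageI K(5))
  qed (auto simp: f K')
qed

lemma submodule_of_submodule:
  assumes N: "left_module R N" and H: "submodule H R N"
  shows "submodule K R (N\<lparr>carrier := H\<rparr>) \<longleftrightarrow> submodule K R N \<and> K \<subseteq> H"
proof -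
  have Hl: "left_module R (N\<lparr>carrier := H\<rparr>)"
    by (rule left_module.submodule_is_left_module[OF N H])
  have incl: "(\<lambda>x. x) \<in> mod_hom R (N\<lparr>carrier := H\<rparr>) N"
    by (rule mod_hom_inclusion[OF left_module.submoduleD(1)[OF N H]])
  show ?thesis
  proof
    assume K: "submodule K R (N\<lparr>carrier := H\<rparr>)"
    then show "submodule K R N \<and> K \<subseteq> H"
      using image_submodule[OF Hl N incl K] left_module.submoduleD(1)[OF Hl K] by simp
  next
    assume K: "submodule K R N \<and> K \<subseteq> H"
    then have "{x \<in> H. x \<in> K} = K" by blast
    then show "submodule K R (N\<lparr>carrier := H\<rparr>)"
      using vimage_submodule[OF Hl N incl conjunct1[OF K]] by simp
  qed
qed

text \<open>The universal property of a quotient: the value at \<open>y\<close> is the value of \<open>g\<close> at any preimage of \<open>y\<close>,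
and the condition on the kernels makes the choice irrelevant.\<close>

lemma mod_hom_factor:
  assumes "left_module R A" "left_module R B" "left_module R C"
    and \<pi>: "\<pi> \<in> mod_hom R A B" and onto: "\<pi> ` carrier A = carrier B"
    and g: "g \<in> mod_hom R A C"
    and ker: "\<And>x. x \<in> carrier A \<Longrightarrow> \<pi> x = \<zero>\<^bsub>B\<^esub> \<Longrightarrow> g x = \<zero>\<^bsub>C\<^esub>"
  obtains f where "f \<in> mod_hom R B C" "\<And>x. x \<in> carrier A \<Longrightarrow> f (\<pi> x) = g x"
proof -
  interpret A: left_module R A by fact
  define s where "s = inv_into (carrier A) \<pi>"
  have s: "s y \<in> carrier A" "\<pi> (s y) = y" if "y \<in> carrier B" for y
    using that onto unfolding s_def by (auto simp: inv_into_into f_inv_into_f)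
  have eq: "g x = g y" if "x \<in> carrier A" "y \<in> carrier A" "\<pi> x = \<pi> y" for x y
    using that ker[of "x \<ominus>\<^bsub>A\<^esub> y"] mod_hom_eq_iff[OF assms(1,2) \<pi>] mod_hom_eq_iff[OF assms(1,3) g]
    by simp
  have fac: "g (s (\<pi> x)) = g x" if "x \<in> carrier A" for x
    using that eq s mod_homD(1)[OF \<pi>] by blast
  have "(\<lambda>y. g (s y)) \<in> mod_hom R B C"
  proof (rule mod_homI)
    show "g (s y) \<in> carrier C" if "y \<in> carrier B" for y
      using that s mod_homD(1)[OF g] by blast
    show "g (s (y \<oplus>\<^bsub>B\<^esub> z)) = g (s y) \<oplus>\<^bsub>C\<^esub> g (s z)" if "y \<in> carrier B" "z \<in> carrier B" for y z
      using that fac[of "s y \<oplus>\<^bsub>A\<^esub> s z"] by (simp add: mod_homD(2)[OF \<pi>] mod_homD(2)[OF g] s)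
    show "g (s (a \<odot>\<^bsub>B\<^esub> y)) = a \<odot>\<^bsub>C\<^esub> g (s y)" if "a \<in> carrier R" "y \<in> carrier B" for a y
      using that fac[of "a \<odot>\<^bsub>A\<^esub> s y"]
      by (simp add: mod_homD(3)[OF \<pi>] mod_homD(3)[OF g] s A.smult_closed)
  qed
  then show thesis
    using fac that by blast
qed

lemma mod_hom_inverse:
  assumes "left_module R A" "left_module R B"
    and f: "f \<in> mod_hom R A B" and bij: "bij_betw f (carrier A) (carrier B)"
  obtains g where "g \<in> mod_hom R B A" "bij_betw g (carrier B) (carrier A)"
    "\<And>x. x \<in> carrier A \<Longrightarrow> g (f x) = x"
proof -
  interpret A: left_module R A by fact
  have "x = \<zero>\<^bsub>A\<^esub>" if "x \<in> carrier A" "f x = \<zero>\<^bsub>B\<^esub>" for x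
    using that bij mod_hom_zero[OF assms(1,2) f]
    by (auto simp: bij_betw_def dest: inj_onD[of f _ x "\<zero>\<^bsub>A\<^esub>"])
  then obtain g where g: "g \<in> mod_hom R B A" "\<And>x. x \<in> carrier A \<Longrightarrow> g (f x) = x"
    using mod_hom_factor[OF assms(1,2,1) f bij_betw_imp_surj_on[OF bij] mod_hom_id] by blast
  have "bij_betw g (carrier B) (carrier A)"
    unfolding bij_betw_imp_surj_on[OF bij, symmetric]
    by (intro bij_betw_byWitness[where f' = f]) (auto simp: g(2))
  then show thesis
    using g that by blast
qed

text \<open>The preimage of \<open>K\<close> is a submodule of \<open>S\<close>, so it is \<open>0\<close> or \<open>S\<close>.\<close>

lemma simple_hom_dichotomy:
  assumes S: "simple_module R S" and N: "left_module R N" and h: "h \<in> mod_hom R S N"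
    and K: "submodule K R N"
  shows "h ` carrier S \<subseteq> K \<or> (\<forall>s\<in>carrier S. h s \<in> K \<longrightarrow> s = \<zero>\<^bsub>S\<^esub>)"
proof -
  have "submodule {s \<in> carrier S. h s \<in> K} R S"
    using vimage_submodule[OF _ N h K] S by (simp add: simple_module_def)
  then have "{s \<in> carrier S. h s \<in> K} = {\<zero>\<^bsub>S\<^esub>} \<or> {s \<in> carrier S. h s \<in> K} = carrier S"
    using S by (simp add: simple_module_def)
  then show ?thesis by blast
qed

section \<open>Quotients on a prescribed type\<close>

text \<open>The module axioms are equations between elements, apart from the existence of negatives, and
so they pass to images under maps that respect the operations.\<close>

lemma left_module_image:
  assumes D: "left_module R D" and onto: "q ` carrier D = carrier G"
    and zero: "q \<zero>\<^bsub>D\<^esub> = \<zero>\<^bsub>G\<^esub>"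
    and add: "\<And>x y. x \<in> carrier D \<Longrightarrow> y \<in> carrier D \<Longrightarrow> q x \<oplus>\<^bsub>G\<^esub> q y = q (x \<oplus>\<^bsub>D\<^esub> y)"
    and smult: "\<And>a x. a \<in> carrier R \<Longrightarrow> x \<in> carrier D \<Longrightarrow> a \<odot>\<^bsub>G\<^esub> q x = q (a \<odot>\<^bsub>D\<^esub> x)"
  shows "left_module R G"
proof -
  interpret D: left_module R D by fact
  have "abelian_group G"
  proof (rule abelian_groupI)
    show "\<exists>y\<in>carrier G. y \<oplus>\<^bsub>G\<^esub> x = \<zero>\<^bsub>G\<^esub>" if "x \<in> carrier G" for x
    proof -
      have "x \<in> q ` carrier D" using that by (simp only: onto)
      then obtain u where u: "u \<in> carrier D" "x = q u" by blast
      have "q (\<ominus>\<^bsub>D\<^esub> u) \<oplus>\<^bsub>G\<^esub> x = \<zero>\<^bsub>G\<^esub>"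
        unfolding u(2) add[OF D.M.a_inv_closed[OF u(1)] u(1)] D.M.l_neg[OF u(1)] by (rule zero)
      moreover have "q (\<ominus>\<^bsub>D\<^esub> u) \<in> carrier G"
        unfolding onto[symmetric] using u by simp
      ultimately show ?thesis by blast
    qed
  qed (auto simp: onto[symmetric] zero[symmetric] add D.M.a_ac)
  then show ?thesis
    by (intro left_module.intro left_module_axioms.intro D.R.ring_axioms)
      (auto simp: onto[symmetric] add smult D.smult_closed D.smult_l_distr D.smult_r_distr
        D.smult_assoc D.smult_one)
qed

text \<open>The cosets of \<open>W\<close> are no more numerous than the elements of \<open>D\<close>, so they can be replaced by
elements of any type into which \<open>D\<close> embeds. In this way a simple subquotient of \<open>M\<close> can be built
on the type of \<open>M\<close>, and a quotient of a finite power of \<open>M\<close> on the type that carries \<open>\<sigma>[M]\<close>.\<close>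

lemma quotient_in_universe:
  fixes D :: "('r, 'd) module"
  assumes D: "left_module R D" and W: "submodule W R D" and small: "carrier D \<lesssim> (UNIV :: 'u set)"
  obtains G :: "('r, 'u) module" and q where "left_module R G" "q \<in> mod_hom R D G"
    "q ` carrier D = carrier G" "\<And>x. x \<in> carrier D \<Longrightarrow> q x = \<zero>\<^bsub>G\<^esub> \<longleftrightarrow> x \<in> W"
proof -
  interpret D: left_module R D by fact
  note WD = D.submoduleD[OF W]
  \<comment> \<open>\<open>c x\<close> is the coset of \<open>x\<close>, \<open>q x\<close> its label, and \<open>s\<close> picks a representative of a labelled coset.\<close>
  define c where "c x = {y \<in> carrier D. y \<ominus>\<^bsub>D\<^esub> x \<in> W}" for x
  have c: "c x = c y \<longleftrightarrow> x \<ominus>\<^bsub>D\<^esub> y \<in> W" if xy: "x \<in> carrier D" "y \<in> carrier D" for x y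
  proof
    have "x \<in> c x"
      using xy WD(2) by (simp add: c_def D.M.minus_eq D.M.r_neg)
    then show "x \<ominus>\<^bsub>D\<^esub> y \<in> W" if "c x = c y"
      unfolding that by (simp add: c_def)
    assume w: "x \<ominus>\<^bsub>D\<^esub> y \<in> W"
    have "z \<ominus>\<^bsub>D\<^esub> x \<in> W \<longleftrightarrow> z \<ominus>\<^bsub>D\<^esub> y \<in> W" if z: "z \<in> carrier D" for z
    proof -
      have 1: "z \<ominus>\<^bsub>D\<^esub> y = (z \<ominus>\<^bsub>D\<^esub> x) \<oplus>\<^bsub>D\<^esub> (x \<ominus>\<^bsub>D\<^esub> y)"
        using xy z by (simp add: D.M.minus_eq D.M.a_assoc D.M.r_neg1)
      show ?thesis
        using WD(3)[OF _ w] D.submodule_add_cancel[OF W _ w, of "z \<ominus>\<^bsub>D\<^esub> x"] xy z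
        unfolding 1 by auto
    qed
    then show "c x = c y" by (auto simp: c_def)
  qed
  have "c ` carrier D \<lesssim> (UNIV :: 'u set)"
    using image_lepoll small by (rule lepoll_trans)
  then obtain \<iota> :: "'d set \<Rightarrow> 'u" where \<iota>: "inj_on \<iota> (c ` carrier D)"
    unfolding lepoll_def by blast
  define q where "q x = \<iota> (c x)" for x
  have q: "q x = q y \<longleftrightarrow> x \<ominus>\<^bsub>D\<^esub> y \<in> W" if "x \<in> carrier D" "y \<in> carrier D" for x y
    unfolding q_def using that c inj_on_eq_iff[OF \<iota>] by simp
  define s where "s = inv_into (carrier D) q"
  have s: "s (q x) \<in> carrier D" "s (q x) \<ominus>\<^bsub>D\<^esub> x \<in> W" if "x \<in> carrier D" for x
  proof -
    show *: "s (q x) \<in> carrier D" unfolding s_def using that by (intro inv_into_into) simp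
    have "q (s (q x)) = q x" unfolding s_def using that by (intro f_inv_into_f) simp
    then show "s (q x) \<ominus>\<^bsub>D\<^esub> x \<in> W" using q * that by blast
  qed
  define G :: "('r, 'u) module" where
    "G = \<lparr>carrier = q ` carrier D, monoid.mult = undefined, one = undefined,
      zero = q \<zero>\<^bsub>D\<^esub>, add = (\<lambda>u v. q (s u \<oplus>\<^bsub>D\<^esub> s v)), smult = (\<lambda>a u. q (a \<odot>\<^bsub>D\<^esub> s u))\<rparr>"
  have add: "q x \<oplus>\<^bsub>G\<^esub> q y = q (x \<oplus>\<^bsub>D\<^esub> y)" if xy: "x \<in> carrier D" "y \<in> carrier D" for x y
  proof -
    have "(s (q x) \<oplus>\<^bsub>D\<^esub> s (q y)) \<ominus>\<^bsub>D\<^esub> (x \<oplus>\<^bsub>D\<^esub> y) = (s (q x) \<ominus>\<^bsub>D\<^esub> x) \<oplus>\<^bsub>D\<^esub> (s (q y) \<ominus>\<^bsub>D\<^esub> y)"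
      using s(1)[OF xy(1)] s(1)[OF xy(2)] xy by (simp add: D.M.minus_eq D.M.minus_add D.M.a_ac)
    then show ?thesis
      using s[OF xy(1)] s[OF xy(2)] xy WD(3) by (simp add: G_def q)
  qed
  have smult: "a \<odot>\<^bsub>G\<^esub> q x = q (a \<odot>\<^bsub>D\<^esub> x)" if a: "a \<in> carrier R" and x: "x \<in> carrier D" for a x
  proof -
    have "(\<ominus>\<^bsub>D\<^esub> (a \<odot>\<^bsub>D\<^esub> x)) = a \<odot>\<^bsub>D\<^esub> (\<ominus>\<^bsub>D\<^esub> x)"
      using a x D.smult_r_distr[of a "\<ominus>\<^bsub>D\<^esub> x" x]
      by (intro D.M.minus_equality) (simp_all add: D.M.l_neg D.smult_r_null D.smult_closed)
    then have "a \<odot>\<^bsub>D\<^esub> s (q x) \<ominus>\<^bsub>D\<^esub> a \<odot>\<^bsub>D\<^esub> x = a \<odot>\<^bsub>D\<^esub> (s (q x) \<ominus>\<^bsub>D\<^esub> x)"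
      using s(1)[OF x] a x by (simp add: D.M.minus_eq D.smult_r_distr)
    then show ?thesis
      using s[OF x] a x WD(5) by (simp add: G_def q D.smult_closed)
  qed
  have onto: "q ` carrier D = carrier G" and zero: "q \<zero>\<^bsub>D\<^esub> = \<zero>\<^bsub>G\<^esub>"
    by (simp_all add: G_def)
  have "q \<in> mod_hom R D G"
    using onto by (intro mod_homI) (auto simp: add smult)
  moreover have "q x = \<zero>\<^bsub>G\<^esub> \<longleftrightarrow> x \<in> W" if "x \<in> carrier D" for x
  proof -
    have "\<ominus>\<^bsub>D\<^esub> \<zero>\<^bsub>D\<^esub> = \<zero>\<^bsub>D\<^esub>" by (rule D.M.minus_equality) simp_all
    then have "x \<ominus>\<^bsub>D\<^esub> \<zero>\<^bsub>D\<^esub> = x"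
      unfolding D.M.minus_eq using D.M.r_zero[OF that] by metis
    then show ?thesis
      unfolding zero[symmetric] using that by (simp add: q)
  qed
  ultimately show thesis
    using that left_module_image[OF D onto zero add smult] onto by blast
qed

section \<open>The trace of a module\<close>

text \<open>The sum of all homomorphic images of \<open>S\<close> in \<open>N\<close>. The elements of this sum are built up one summand at
a time, so that facts about them follow by induction instead of by manipulating finite sums.\<close>

inductive_set trace ::
    "('r, 'x) ring_scheme \<Rightarrow> ('r, 's) module \<Rightarrow> ('r, 'n) module \<Rightarrow> 'n set"
  for R S N where
    trace_zero: "\<zero>\<^bsub>N\<^esub> \<in> trace R S N"
  | trace_step: "\<lbrakk>x \<in> trace R S N; h \<in> mod_hom R S N; s \<in> carrier S\<rbrakk> \<Longrightarrow>
      x \<oplus>\<^bsub>N\<^esub> h s \<in> trace R S N"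

lemma trace_submodule:
  assumes "left_module R S" "left_module R N"
  shows "submodule (trace R S N) R N"
proof -
  interpret S: left_module R S by fact
  interpret N: left_module R N by fact
  have sub: "x \<in> carrier N" if "x \<in> trace R S N" for x
    using that by induction (auto intro: mod_homD(1))
  show ?thesis
  proof (rule N.submoduleI)
    show "x \<oplus>\<^bsub>N\<^esub> y \<in> trace R S N" if x: "x \<in> trace R S N" and y: "y \<in> trace R S N" for x y
      using y
    proof induction
      case trace_zero
      then show ?case using x sub by simp
    next
      case (trace_step y h s)
      then have "(x \<oplus>\<^bsub>N\<^esub> y) \<oplus>\<^bsub>N\<^esub> h s \<in> trace R S N"
        by (intro trace.trace_step[OF trace_step.IH])
      then show ?case
        using x trace_step sub by (simp add: N.M.a_assoc mod_homD(1))
    qed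
    show "a \<odot>\<^bsub>N\<^esub> x \<in> trace R S N" if a: "a \<in> carrier R" and x: "x \<in> trace R S N" for a x
      using x
    proof induction
      case trace_zero
      then show ?case using a by (simp add: N.smult_r_null trace.trace_zero)
    next
      case (trace_step x h s)
      then have "a \<odot>\<^bsub>N\<^esub> x \<oplus>\<^bsub>N\<^esub> h (a \<odot>\<^bsub>S\<^esub> s) \<in> trace R S N"
        using a by (intro trace.trace_step[OF trace_step.IH]) (auto intro: S.smult_closed)
      then show ?case
        using a trace_step sub by (simp add: N.smult_r_distr mod_homD)
    qed
  qed (auto simp: sub intro: trace.trace_zero)
qed

lemma hom_image_in_trace:
  assumes "left_module R N" "h \<in> mod_hom R S N" "s \<in> carrier S"
  shows "h s \<in> trace R S N"
proof -
  interpret N: left_module R N by fact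
  show ?thesis
    using trace_step[OF trace_zero assms(2,3)] mod_homD(1)[OF assms(2,3)] by simp
qed

lemma trace_least:
  assumes "left_module R N" "submodule K R N"
    and "\<And>h s. h \<in> mod_hom R S N \<Longrightarrow> s \<in> carrier S \<Longrightarrow> h s \<in> K"
  shows "trace R S N \<subseteq> K"
proof
  show "x \<in> K" if "x \<in> trace R S N" for x
    using that
    by induction (auto intro: left_module.submoduleD(2,3)[OF assms(1,2)] assms(3))
qed

text \<open>Composing with \<open>f\<close> turns homomorphisms \<open>S \<rightarrow> N\<close> into homomorphisms \<open>S \<rightarrow> N'\<close>. In particular the trace
is fully invariant.\<close>

lemma mod_hom_trace:
  assumes "left_module R S" "left_module R N" "left_module R N'" "f \<in> mod_hom R N N'"
  shows "f ` trace R S N \<subseteq> trace R S N'"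
proof -
  have "trace R S N \<subseteq> {x \<in> carrier N. f x \<in> trace R S N'}"
    using assms trace_submodule[OF assms(1,3)]
    by (intro trace_least vimage_submodule)
      (auto intro: mod_homD(1) hom_image_in_trace[OF assms(3) mod_hom_comp[OF _ assms(4)]])
  then show ?thesis by blast
qed

lemma trace_fully_invariant:
  assumes "left_module R S" "left_module R N"
  shows "fully_invariant R N (trace R S N)"
  using trace_submodule mod_hom_trace assms unfolding fully_invariant_def by blast

lemma trace_image_onto:
  assumes "left_module R S" "left_module R N" "left_module R N'" "f \<in> mod_hom R N N'"
    and "f ` carrier N = carrier N'" "trace R S N = carrier N"
  shows "trace R S N' = carrier N'"
  using mod_hom_trace[OF assms(1-4)] assms(5,6)
    left_module.submoduleD(1)[OF assms(3) trace_submodule[OF assms(1,3)]] by blast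

section \<open>Direct sums\<close>

lemma carrier_direct_sum:
  assumes "\<forall>i\<in>I. left_module R (A i)"
  shows "carrier (direct_sum I A) =
    {x \<in> \<Pi>\<^sub>E i\<in>I. carrier (A i). finite {i \<in> I. x i \<noteq> \<zero>\<^bsub>A i\<^esub>}}"
proof -
  have "group (add_monoid (A i))" if "i \<in> I" for i
    using assms that by (auto simp: left_module_def intro: abelian_group.a_group)
  then show ?thesis
    by (simp add: direct_sum_def carrier_sum_group)
qed

lemma direct_sum_ops:
  "\<zero>\<^bsub>direct_sum I A\<^esub> = (\<lambda>i\<in>I. \<zero>\<^bsub>A i\<^esub>)"
  "x \<oplus>\<^bsub>direct_sum I A\<^esub> y = (\<lambda>i\<in>I. x i \<oplus>\<^bsub>A i\<^esub> y i)"
  "a \<odot>\<^bsub>direct_sum I A\<^esub> x = (\<lambda>i\<in>I. a \<odot>\<^bsub>A i\<^esub> x i)"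
  by (simp_all add: direct_sum_def)

lemma direct_sumD:
  assumes "\<forall>i\<in>I. left_module R (A i)" "x \<in> carrier (direct_sum I A)"
  shows "\<And>i. i \<in> I \<Longrightarrow> x i \<in> carrier (A i)" "x \<in> extensional I"
    "finite {i \<in> I. x i \<noteq> \<zero>\<^bsub>A i\<^esub>}"
  using assms(2) unfolding carrier_direct_sum[OF assms(1)] by (auto simp: PiE_iff)

lemma direct_sumI:
  assumes "\<forall>i\<in>I. left_module R (A i)" "\<And>i. i \<in> I \<Longrightarrow> x i \<in> carrier (A i)"
    "x \<in> extensional I" "finite {i \<in> I. x i \<noteq> \<zero>\<^bsub>A i\<^esub>}"
  shows "x \<in> carrier (direct_sum I A)"
  using assms(2-) unfolding carrier_direct_sum[OF assms(1)] by (auto simp: PiE_iff)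

lemma direct_sum_left_module:
  assumes "ring R" and A: "\<forall>i\<in>I. left_module R (A i)"
  shows "left_module R (direct_sum I A)"
proof -
  have "comm_group (add_monoid (A i))" if "i \<in> I" for i
    using A that by (auto simp: left_module_def intro: abelian_group.a_comm_group)
  then have grp: "group (sum_group I (\<lambda>i. add_monoid (A i)))"
    by (intro sum_group) (auto simp: comm_group_def)
  interpret G: group "sum_group I (\<lambda>i. add_monoid (A i))" by fact
  have eqs: "carrier (direct_sum I A) = carrier (sum_group I (\<lambda>i. add_monoid (A i)))"
    "add (direct_sum I A) = monoid.mult (sum_group I (\<lambda>i. add_monoid (A i)))"
    "zero (direct_sum I A) = one (sum_group I (\<lambda>i. add_monoid (A i)))"
    by (simp_all add: direct_sum_def)
  note D = direct_sumD[OF A]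
  have "abelian_group (direct_sum I A)"
  proof (rule abelian_groupI, goal_cases)
    case (4 x y)
    have "x i \<oplus>\<^bsub>A i\<^esub> y i = y i \<oplus>\<^bsub>A i\<^esub> x i" if "i \<in> I" for i
      using D(1)[OF 4(1) that] D(1)[OF 4(2) that] A that
      by (auto simp: left_module_def intro!: abelian_monoid.a_comm abelian_group.axioms)
    then show ?case
      by (auto simp: direct_sum_ops intro!: restrict_ext)
  qed (simp_all only: eqs G.m_closed G.one_closed G.m_assoc G.l_one G.l_inv_ex)
  moreover have "left_module_axioms R (direct_sum I A)"
  proof (rule left_module_axioms.intro, goal_cases)
    case (1 a x)
    have "finite {i \<in> I. a \<odot>\<^bsub>A i\<^esub> x i \<noteq> \<zero>\<^bsub>A i\<^esub>}"
      using D(3)[OF 1(2)] by (rule finite_subset[rotated])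
        (use 1 A left_module.smult_r_null in fastforce)+
    then show ?case
      using 1 D(1)[OF 1(2)] A
      by (intro direct_sumI[OF A])
        (auto simp: direct_sum_ops cong: conj_cong intro: left_module.smult_closed)
  next
    case (2 a b x)
    then show ?case using D(1)[OF 2(3)] A
      by (auto simp: direct_sum_ops left_module.smult_l_distr intro!: restrict_ext)
  next
    case (3 a x y)
    then show ?case using D(1)[OF 3(2)] D(1)[OF 3(3)] A
      by (auto simp: direct_sum_ops left_module.smult_r_distr[of R] intro!: restrict_ext)
  next
    case (4 a b x)
    then show ?case using D(1)[OF 4(3)] A
      by (auto simp: direct_sum_ops left_module.smult_assoc intro!: restrict_ext)
  next
    case (5 x)
    then show ?case using D(1,2)[OF 5] A
      by (auto simp: direct_sum_ops left_module.smult_one extensional_def)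
  qed
  ultimately show ?thesis
    using assms(1) by (simp add: left_module_def)
qed

definition dsum_in :: "'i set \<Rightarrow> ('i \<Rightarrow> ('r, 'm) module) \<Rightarrow> 'i \<Rightarrow> 'm \<Rightarrow> 'i \<Rightarrow> 'm"
  where "dsum_in I A i a = (\<lambda>j\<in>I. if j = i then a else \<zero>\<^bsub>A j\<^esub>)"

lemma dsum_in_hom:
  assumes A: "\<forall>i\<in>I. left_module R (A i)" and i: "i \<in> I"
  shows "dsum_in I A i \<in> mod_hom R (A i) (direct_sum I A)"
proof (rule mod_homI)
  have z: "\<zero>\<^bsub>A j\<^esub> \<oplus>\<^bsub>A j\<^esub> \<zero>\<^bsub>A j\<^esub> = \<zero>\<^bsub>A j\<^esub>" "\<zero>\<^bsub>A j\<^esub> \<in> carrier (A j)" if "j \<in> I" for j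
    using A that by (auto simp: left_module_def abelian_group_def
        intro!: abelian_monoid.l_zero abelian_monoid.zero_closed)
  show "dsum_in I A i x \<in> carrier (direct_sum I A)" if "x \<in> carrier (A i)" for x
    using that z
    by (intro direct_sumI[OF A] finite_subset[of "{j \<in> I. dsum_in I A i x j \<noteq> \<zero>\<^bsub>A j\<^esub>}" "{i}"])
      (auto simp: dsum_in_def split: if_splits)
  show "dsum_in I A i (x \<oplus>\<^bsub>A i\<^esub> y) = dsum_in I A i x \<oplus>\<^bsub>direct_sum I A\<^esub> dsum_in I A i y" for x y
    using z by (auto simp: dsum_in_def direct_sum_ops intro!: restrict_ext)
  show "dsum_in I A i (a \<odot>\<^bsub>A i\<^esub> x) = a \<odot>\<^bsub>direct_sum I A\<^esub> dsum_in I A i x" if "a \<in> carrier R" for a x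
    using that A
    by (auto simp: dsum_in_def direct_sum_ops left_module.smult_r_null[of R] intro!: restrict_ext)
qed

lemma dsum_proj_hom:
  assumes "\<forall>i\<in>I. left_module R (A i)" "i \<in> I"
  shows "(\<lambda>x. x i) \<in> mod_hom R (direct_sum I A) (A i)"
  using assms by (intro mod_homI) (auto simp: direct_sum_ops dest: direct_sumD(1))

text \<open>Each element of a direct sum is a finite sum of elements of the summands. The induction is on a finite
set that contains the support.\<close>

lemma trace_direct_sum:
  assumes S: "left_module R S" and A: "\<forall>i\<in>I. left_module R (A i)"
    and gen: "\<And>i. i \<in> I \<Longrightarrow> trace R S (A i) = carrier (A i)"
  shows "trace R S (direct_sum I A) = carrier (direct_sum I A)" (is "?T = carrier ?D")
proof -
  have "ring R" using S by (simp add: left_module_def)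
  then have D: "left_module R ?D" using A by (rule direct_sum_left_module)
  interpret D: left_module R ?D by fact
  note T = D.submoduleD[OF trace_submodule[OF S D]]
  have "\<forall>x \<in> carrier ?D. {i \<in> I. x i \<noteq> \<zero>\<^bsub>A i\<^esub>} \<subseteq> F \<longrightarrow> x \<in> ?T" if "finite F" for F
    using that
  proof induction
    case empty
    have "x = \<zero>\<^bsub>?D\<^esub>" if "x \<in> carrier ?D" "{i \<in> I. x i \<noteq> \<zero>\<^bsub>A i\<^esub>} \<subseteq> {}" for x
      using that direct_sumD(2)[OF A that(1)] by (auto simp: direct_sum_ops extensional_def)
    then show ?case using T(2) by blast
  next
    case (insert i F)
    show ?case
    proof (intro ballI impI)
      fix x assume x: "x \<in> carrier ?D" and supp: "{j \<in> I. x j \<noteq> \<zero>\<^bsub>A j\<^esub>} \<subseteq> insert i F"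
      show "x \<in> ?T"
      proof (cases "i \<in> I")
        case False
        then show ?thesis using insert.IH x supp by blast
      next
        case True
        interpret Ai: left_module R "A i" using A True by simp
        note xD = direct_sumD[OF A x]
        define y where "y = x(i := \<zero>\<^bsub>A i\<^esub>)"
        have "y \<in> carrier ?D"
          using xD True
          by (intro direct_sumI[OF A] finite_subset[OF _ xD(3)])
            (auto simp: y_def extensional_def)
        moreover have "{j \<in> I. y j \<noteq> \<zero>\<^bsub>A j\<^esub>} \<subseteq> F"
          using supp by (auto simp: y_def)
        ultimately have "y \<in> ?T" using insert.IH by blast
        moreover have "dsum_in I A i (x i) \<in> ?T"
          using mod_hom_trace[OF S A[rule_format, OF True] D dsum_in_hom[OF A True]] gen[OF True] xD(1)[OF True]
          by blast
        moreover have "x = y \<oplus>\<^bsub>?D\<^esub> dsum_in I A i (x i)"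
        proof
          show "x j = (y \<oplus>\<^bsub>?D\<^esub> dsum_in I A i (x i)) j" for j
            using xD(1,2) True A
            by (auto simp: y_def dsum_in_def direct_sum_ops extensional_def left_module_def
                abelian_group_def abelian_monoid.l_zero abelian_monoid.r_zero)
        qed
        ultimately show ?thesis using T(3) by metis
      qed
    qed
  qed
  then have "x \<in> ?T" if "x \<in> carrier ?D" for x
    using direct_sumD(3)[OF A that] that by blast
  then show ?thesis using T(1) by blast
qed

lemma (in left_module) finsum_smult:
  assumes "finite F" "a \<in> carrier R" "f \<in> F \<rightarrow> carrier M"
  shows "a \<odot>\<^bsub>M\<^esub> (\<Oplus>\<^bsub>M\<^esub>i\<in>F. f i) = (\<Oplus>\<^bsub>M\<^esub>i\<in>F. a \<odot>\<^bsub>M\<^esub> f i)"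
  using assms
proof (induction F)
  case empty
  then show ?case by (simp add: smult_r_null)
next
  case (insert i F)
  then have "f i \<in> carrier M" "f \<in> F \<rightarrow> carrier M" "(\<lambda>i. a \<odot>\<^bsub>M\<^esub> f i) \<in> F \<rightarrow> carrier M"
    by (auto intro: smult_closed)
  then show ?case
    using insert by (simp add: smult_r_distr smult_closed)
qed

text \<open>The homomorphism that the universal property of the direct sum assigns to the family \<open>h\<close>. The sum
extends over the support of \<open>x\<close> because a \<open>finsum\<close> over an infinite set is \<open>0\<close> by convention.\<close>

definition copair ::
    "'i set \<Rightarrow> ('i \<Rightarrow> ('r, 'm) module) \<Rightarrow> ('r, 'n) module \<Rightarrow> ('i \<Rightarrow> 'm \<Rightarrow> 'n) \<Rightarrow> ('i \<Rightarrow> 'm) \<Rightarrow> 'n"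
  where "copair I A N h x = (\<Oplus>\<^bsub>N\<^esub>i\<in>{i \<in> I. x i \<noteq> \<zero>\<^bsub>A i\<^esub>}. h i (x i))"

context
  fixes R :: "('r, 'x) ring_scheme" and I :: "'i set" and A :: "'i \<Rightarrow> ('r, 'm) module"
    and N :: "('r, 'n) module" and h :: "'i \<Rightarrow> 'm \<Rightarrow> 'n"
  assumes N: "left_module R N" and A: "\<forall>i\<in>I. left_module R (A i)"
    and h: "\<forall>i\<in>I. h i \<in> mod_hom R (A i) N"
begin

interpretation N: left_module R N by (rule N)

text \<open>The support may be enlarged to any finite set, so that elements with different supports can be
compared.\<close>

lemma copair_eq_finsum:
  assumes "x \<in> carrier (direct_sum I A)" "finite F" "F \<subseteq> I" "{i \<in> I. x i \<noteq> \<zero>\<^bsub>A i\<^esub>} \<subseteq> F"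
  shows "copair I A N h x = (\<Oplus>\<^bsub>N\<^esub>i\<in>F. h i (x i))"
  unfolding copair_def
proof (rule N.M.add.finprod_mono_neutral_cong_left)
  show "h i (x i) = \<zero>\<^bsub>N\<^esub>" if "i \<in> F - {i \<in> I. x i \<noteq> \<zero>\<^bsub>A i\<^esub>}" for i
    using that assms(3) mod_hom_zero[OF A[rule_format] N h[rule_format], of i] by auto
  show "(\<lambda>i. h i (x i)) \<in> F \<rightarrow> carrier N"
    using assms(3) direct_sumD(1)[OF A assms(1)] mod_homD(1)[OF h[rule_format]] by blast
qed (use assms in auto)

lemma copair_hom: "copair I A N h \<in> mod_hom R (direct_sum I A) N"
proof -
  have "left_module R (direct_sum I A)"
    using N A by (intro direct_sum_left_module) (auto simp: left_module_def)
  interpret D: left_module R "direct_sum I A" by fact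
  have Pi: "(\<lambda>i. h i (x i)) \<in> F \<rightarrow> carrier N"
    if "x \<in> carrier (direct_sum I A)" "F \<subseteq> I" for x F
    using that direct_sumD(1)[OF A that(1)] mod_homD(1)[OF h[rule_format]] by blast
  show ?thesis
  proof (rule mod_homI)
    show "copair I A N h x \<in> carrier N" if "x \<in> carrier (direct_sum I A)" for x
      unfolding copair_def using that by (intro N.M.finsum_closed Pi) auto
  next
    fix x y assume x: "x \<in> carrier (direct_sum I A)" and y: "y \<in> carrier (direct_sum I A)"
    define F where "F = {i \<in> I. x i \<noteq> \<zero>\<^bsub>A i\<^esub>} \<union> {i \<in> I. y i \<noteq> \<zero>\<^bsub>A i\<^esub>}"
    have F: "finite F" "F \<subseteq> I"
      using direct_sumD(3)[OF A x] direct_sumD(3)[OF A y] by (auto simp: F_def)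
    have "x i \<oplus>\<^bsub>A i\<^esub> y i = \<zero>\<^bsub>A i\<^esub>" if "i \<in> I" "i \<notin> F" for i
      using that A by (auto simp: F_def left_module_def abelian_group_def
          intro!: abelian_monoid.l_zero abelian_monoid.zero_closed)
    then have supp: "{i \<in> I. (x \<oplus>\<^bsub>direct_sum I A\<^esub> y) i \<noteq> \<zero>\<^bsub>A i\<^esub>} \<subseteq> F"
      by (auto simp: direct_sum_ops)
    have "copair I A N h (x \<oplus>\<^bsub>direct_sum I A\<^esub> y) =
        (\<Oplus>\<^bsub>N\<^esub>i\<in>F. h i ((x \<oplus>\<^bsub>direct_sum I A\<^esub> y) i))"
      by (rule copair_eq_finsum[OF D.M.a_closed[OF x y] F supp])
    also have "\<dots> = (\<Oplus>\<^bsub>N\<^esub>i\<in>F. h i (x i) \<oplus>\<^bsub>N\<^esub> h i (y i))"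
      using Pi[OF x F(2)] Pi[OF y F(2)] F(2)
      by (intro N.M.finsum_cong')
        (auto simp: direct_sum_ops Pi_iff subset_eq
          intro!: mod_homD(2)[OF h[rule_format]] direct_sumD(1)[OF A] x y)
    also have "\<dots> = copair I A N h x \<oplus>\<^bsub>N\<^esub> copair I A N h y"
      using N.M.finsum_addf[OF Pi[OF x F(2)] Pi[OF y F(2)]]
        copair_eq_finsum[OF x F] copair_eq_finsum[OF y F] by (auto simp: F_def)
    finally show "copair I A N h (x \<oplus>\<^bsub>direct_sum I A\<^esub> y) = copair I A N h x \<oplus>\<^bsub>N\<^esub> copair I A N h y" .
  next
    fix a x assume a: "a \<in> carrier R" and x: "x \<in> carrier (direct_sum I A)"
    define F where "F = {i \<in> I. x i \<noteq> \<zero>\<^bsub>A i\<^esub>}"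
    have F: "finite F" "F \<subseteq> I"
      using direct_sumD(3)[OF A x] by (auto simp: F_def)
    have supp: "{i \<in> I. (a \<odot>\<^bsub>direct_sum I A\<^esub> x) i \<noteq> \<zero>\<^bsub>A i\<^esub>} \<subseteq> F"
      using A a by (auto simp: direct_sum_ops F_def left_module.smult_r_null[of R])
    have "copair I A N h (a \<odot>\<^bsub>direct_sum I A\<^esub> x) = (\<Oplus>\<^bsub>N\<^esub>i\<in>F. h i ((a \<odot>\<^bsub>direct_sum I A\<^esub> x) i))"
      by (rule copair_eq_finsum[OF D.smult_closed[OF a x] F supp])
    also have "\<dots> = (\<Oplus>\<^bsub>N\<^esub>i\<in>F. a \<odot>\<^bsub>N\<^esub> h i (x i))"
      using F(2) Pi[OF x F(2)] direct_sumD(1)[OF A x] a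
      by (intro N.M.finsum_cong')
        (auto simp: direct_sum_ops mod_homD(3)[OF h[rule_format]] intro!: N.smult_closed)
    also have "\<dots> = a \<odot>\<^bsub>N\<^esub> copair I A N h x"
      unfolding copair_def F_def[symmetric] using N.finsum_smult[OF F(1) a Pi[OF x F(2)]] by simp
    finally show "copair I A N h (a \<odot>\<^bsub>direct_sum I A\<^esub> x) = a \<odot>\<^bsub>N\<^esub> copair I A N h x" .
  qed
qed

lemma copair_dsum_in:
  assumes i: "i \<in> I" and a: "a \<in> carrier (A i)"
  shows "copair I A N h (dsum_in I A i a) = h i a"
proof -
  have "copair I A N h (dsum_in I A i a) = (\<Oplus>\<^bsub>N\<^esub>j\<in>{i}. h j (dsum_in I A i a j))"
    using i by (intro copair_eq_finsum mod_homD(1)[OF dsum_in_hom[OF A i] a])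
      (auto simp: dsum_in_def split: if_splits)
  then show ?thesis
    using i mod_homD(1)[OF h[rule_format, OF i] a] by (simp add: dsum_in_def)
qed

lemma restrict_direct_sum:
  assumes "x \<in> carrier (direct_sum I A)" "J \<subseteq> I"
  shows "restrict x J \<in> carrier (direct_sum J A)"
  using assms direct_sumD[OF A assms(1)]
  by (intro direct_sumI[of J R]) (use A in \<open>auto intro: rev_finite_subset\<close>)

lemma copair_restrict:
  assumes "x \<in> carrier (direct_sum I A)" "J \<subseteq> I" "{i \<in> I. x i \<noteq> \<zero>\<^bsub>A i\<^esub>} \<subseteq> J"
  shows "copair J A N h (restrict x J) = copair I A N h x"
proof -
  have eq: "{i \<in> J. restrict x J i \<noteq> \<zero>\<^bsub>A i\<^esub>} = {i \<in> I. x i \<noteq> \<zero>\<^bsub>A i\<^esub>}"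
    using assms(2,3) by auto
  show ?thesis
    unfolding copair_def eq using assms direct_sumD(1)[OF A assms(1)] mod_homD(1)[OF h[rule_format]]
    by (intro N.M.finsum_cong') auto
qed

end

lemma copair_insert:
  assumes N: "left_module R N" and A: "\<forall>j\<in>insert i J. left_module R (A j)"
    and h: "\<forall>j\<in>insert i J. h j \<in> mod_hom R (A j) N"
    and i: "i \<notin> J" and x: "x \<in> carrier (direct_sum (insert i J) A)"
  shows "copair (insert i J) A N h x = h i (x i) \<oplus>\<^bsub>N\<^esub> copair J A N h (restrict x J)"
proof -
  interpret N: left_module R N by fact
  have xJ: "restrict x J \<in> carrier (direct_sum J A)"
    using restrict_direct_sum[OF N A h x] by blast
  define F where "F = {j \<in> J. x j \<noteq> \<zero>\<^bsub>A j\<^esub>}"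
  have F: "finite F" "F \<subseteq> J" "i \<notin> F"
    using direct_sumD(3)[OF A x] i by (auto simp: F_def intro: rev_finite_subset)
  have hx: "h j (x j) \<in> carrier N" if "j \<in> insert i J" for j
    using direct_sumD(1)[OF A x that] mod_homD(1)[OF h[rule_format, OF that]] by blast
  have "copair (insert i J) A N h x = (\<Oplus>\<^bsub>N\<^esub>j\<in>insert i F. h j (x j))"
    using F by (intro copair_eq_finsum[OF N A h x]) (auto simp: F_def)
  also have "\<dots> = h i (x i) \<oplus>\<^bsub>N\<^esub> (\<Oplus>\<^bsub>N\<^esub>j\<in>F. h j (x j))"
    using F hx by (intro N.M.finsum_insert) auto
  also have "(\<Oplus>\<^bsub>N\<^esub>j\<in>F. h j (x j)) = copair J A N h (restrict x J)"
  proof -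
    have "{j \<in> J. restrict x J j \<noteq> \<zero>\<^bsub>A j\<^esub>} = F" by (auto simp: F_def)
    then show ?thesis
      unfolding copair_def using F hx by (auto intro!: N.M.finsum_cong')
  qed
  finally show ?thesis .
qed

section \<open>Complements in modules generated by a simple module\<close>

text \<open>The direct sum is a complement of \<open>H\<close> in \<open>N\<close>. Zorn's lemma gives a maximal family of copies of \<open>S\<close>
in \<open>N\<close> whose sum is direct and meets \<open>H\<close> only in \<open>0\<close>. A homomorphic image of \<open>S\<close> that is not contained
in the sum of \<open>H\<close> and this family meets that sum only in \<open>0\<close>, because \<open>S\<close> is simple, and could be added
to the family. So \<open>H\<close> and the family together span the trace of \<open>S\<close>, which is \<open>N\<close>. The copies are
indexed by the images of a fixed non-zero element of \<open>S\<close>, so that the index set consists of elements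
of \<open>N\<close>.\<close>

lemma complement_as_direct_sum:
  fixes S :: "('r, 's) module" and N :: "('r, 'n) module"
  assumes S: "simple_module R S" and N: "left_module R N"
    and gen: "trace R S N = carrier N" and H: "submodule H R N"
  obtains B :: "'n set" and \<phi> where "\<phi> \<in> mod_hom R (direct_sum B (\<lambda>_. S)) N"
    and "\<And>x. x \<in> carrier (direct_sum B (\<lambda>_. S)) \<Longrightarrow> \<phi> x \<in> H \<Longrightarrow> x = \<zero>\<^bsub>direct_sum B (\<lambda>_. S)\<^esub>"
    and "\<And>y. y \<in> carrier N \<Longrightarrow>
      \<exists>u\<in>H. \<exists>x\<in>carrier (direct_sum B (\<lambda>_. S)). y = u \<oplus>\<^bsub>N\<^esub> \<phi> x"
proof -
  have Sl: "left_module R S" using S by (simp add: simple_module_def)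
  interpret S: left_module R S by fact
  interpret N: left_module R N by fact
  have const: "\<forall>i\<in>B. left_module R ((\<lambda>_. S) i)" for B :: "'n set" using Sl by simp
  have Dl: "left_module R (direct_sum B (\<lambda>_. S))" for B :: "'n set"
    using Sl by (intro direct_sum_left_module S.R.ring_axioms) simp
  obtain s0 where s0: "s0 \<in> carrier S" "s0 \<noteq> \<zero>\<^bsub>S\<^esub>"
  proof -
    have "carrier S \<noteq> {\<zero>\<^bsub>S\<^esub>}"
      using S by (simp add: simple_module_def nonzero_module_def)
    then show ?thesis using that S.M.zero_closed by blast
  qed
  define Y where "Y = (\<lambda>h. h s0) ` mod_hom R S N"
  define g where "g = (\<lambda>y. SOME h. h \<in> mod_hom R S N \<and> h s0 = y)"
  have g: "g y \<in> mod_hom R S N" "g y s0 = y" if "y \<in> Y" for y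
    using someI_ex[of "\<lambda>h. h \<in> mod_hom R S N \<and> h s0 = y"] that by (auto simp: Y_def g_def)
  define \<Phi> where "\<Phi> B = copair B (\<lambda>_. S) N g" for B
  have \<Phi>: "\<Phi> B \<in> mod_hom R (direct_sum B (\<lambda>_. S)) N" if "B \<subseteq> Y" for B
    unfolding \<Phi>_def using that g by (intro copair_hom N const) blast
  define \<A> where "\<A> = {B. B \<subseteq> Y \<and> (\<forall>x\<in>carrier (direct_sum B (\<lambda>_. S)).
    \<Phi> B x \<in> H \<longrightarrow> x = \<zero>\<^bsub>direct_sum B (\<lambda>_. S)\<^esub>)}"
  have "\<exists>B\<in>\<A>. \<forall>X\<in>\<A>. B \<subseteq> X \<longrightarrow> X = B"
  proof (rule subset_Zorn_nonempty)
    have "x = \<zero>\<^bsub>direct_sum {} (\<lambda>_. S)\<^esub>" if "x \<in> carrier (direct_sum {} (\<lambda>_. S))" for x :: "'n \<Rightarrow> 's"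
      using direct_sumD(2)[OF const that] by (auto simp: direct_sum_ops restrict_def)
    then show "\<A> \<noteq> {}" unfolding \<A>_def by blast
  next
    \<comment> \<open>A relation over the union of a chain has finite support, hence already lives over one member.\<close>
    fix \<C> assume ne: "\<C> \<noteq> {}" and "subset.chain \<A> \<C>"
    then have \<C>: "\<C> \<subseteq> \<A>" and chain: "subset.chain UNIV \<C>"
      by (auto simp: subset.chain_def)
    have sub: "\<Union>\<C> \<subseteq> Y" using \<C> by (auto simp: \<A>_def)
    have "x = \<zero>\<^bsub>direct_sum (\<Union>\<C>) (\<lambda>_. S)\<^esub>"
      if x: "x \<in> carrier (direct_sum (\<Union>\<C>) (\<lambda>_. S))" and xH: "\<Phi> (\<Union>\<C>) x \<in> H" for x
    proof -
      obtain B where B: "B \<in> \<C>" "{i \<in> \<Union>\<C>. x i \<noteq> \<zero>\<^bsub>S\<^esub>} \<subseteq> B"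
        using finite_subset_Union_chain[OF direct_sumD(3)[OF const x] _ ne chain] by blast
      then have BC: "B \<subseteq> \<Union>\<C>" by blast
      have gC: "\<forall>i\<in>\<Union>\<C>. g i \<in> mod_hom R S N" using sub g by blast
      have "\<Phi> B (restrict x B) = \<Phi> (\<Union>\<C>) x"
        unfolding \<Phi>_def by (rule copair_restrict[OF N const gC x BC B(2)])
      moreover have "restrict x B \<in> carrier (direct_sum B (\<lambda>_. S))"
        by (rule restrict_direct_sum[OF N const gC x BC])
      ultimately have "restrict x B = \<zero>\<^bsub>direct_sum B (\<lambda>_. S)\<^esub>"
        using B(1) \<C> xH by (auto simp: \<A>_def)
      then have "x i = \<zero>\<^bsub>S\<^esub>" if "i \<in> \<Union>\<C>" for i
        using that B(2) by (auto simp: direct_sum_ops restrict_def fun_eq_iff split: if_splits)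
      then show ?thesis
        using direct_sumD(2)[OF const x] by (auto simp: direct_sum_ops extensional_def)
    qed
    then show "\<Union>\<C> \<in> \<A>" using sub unfolding \<A>_def by blast
  qed
  then obtain B where B: "B \<in> \<A>" and max: "\<And>X. X \<in> \<A> \<Longrightarrow> B \<subseteq> X \<Longrightarrow> X = B"
    by blast
  have BY: "B \<subseteq> Y" and indep: "\<And>x. x \<in> carrier (direct_sum B (\<lambda>_. S)) \<Longrightarrow> \<Phi> B x \<in> H \<Longrightarrow>
      x = \<zero>\<^bsub>direct_sum B (\<lambda>_. S)\<^esub>"
    using B by (auto simp: \<A>_def)
  define C where "C = \<Phi> B ` carrier (direct_sum B (\<lambda>_. S))"
  have C: "submodule C R N"
    unfolding C_def by (intro image_submodule[OF Dl N \<Phi>[OF BY]] left_module.carrier_submodule Dl)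
  define D where "D = {u \<oplus>\<^bsub>N\<^esub> v |u v. u \<in> H \<and> v \<in> C}"
  have D: "submodule D R N" unfolding D_def by (rule N.sum_submodule[OF H C])
  note HD = N.submoduleD[OF H] and CD = N.submoduleD[OF C] and DD = N.submoduleD[OF D]
  have "H \<subseteq> D"
    using HD(1) CD(2) unfolding D_def by (force simp: subset_eq)
  have "C \<subseteq> D"
    using CD(1) HD(2) unfolding D_def by (force simp: subset_eq)
  have "h s \<in> D" if h: "h \<in> mod_hom R S N" and s: "s \<in> carrier S" for h s
  proof (rule ccontr)
    assume "h s \<notin> D"
    then have "h s0 \<notin> D"
      using simple_hom_dichotomy[OF S N h D] s s0 by blast
    define y where "y = h s0"
    have y: "y \<in> Y" "y \<notin> D" using h \<open>h s0 \<notin> D\<close> by (auto simp: y_def Y_def)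
    have "g y s0 \<notin> D" using g(2)[OF y(1)] y(2) by simp
    then have inj: "s = \<zero>\<^bsub>S\<^esub>" if "s \<in> carrier S" "g y s \<in> D" for s
      using simple_hom_dichotomy[OF S N g(1)[OF y(1)] D] that s0(1) by blast
    have "y \<notin> B"
    proof
      assume yB: "y \<in> B"
      have gB: "\<forall>i\<in>B. g i \<in> mod_hom R S N" using BY g by blast
      have "\<Phi> B (dsum_in B (\<lambda>_. S) y s0) = y"
        unfolding \<Phi>_def using copair_dsum_in[OF N const gB yB s0(1)] g(2)[OF y(1)] by simp
      moreover have "dsum_in B (\<lambda>_. S) y s0 \<in> carrier (direct_sum B (\<lambda>_. S))"
        by (rule mod_homD(1)[OF dsum_in_hom[OF const yB] s0(1)])
      ultimately have "y \<in> C" unfolding C_def by (metis image_eqI)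
      then show False using y(2) \<open>C \<subseteq> D\<close> by blast
    qed
    have sub: "insert y B \<subseteq> Y" using BY y by blast
    have gi: "\<forall>i\<in>insert y B. g i \<in> mod_hom R S N" using sub g by blast
    have "x = \<zero>\<^bsub>direct_sum (insert y B) (\<lambda>_. S)\<^esub>"
      if x: "x \<in> carrier (direct_sum (insert y B) (\<lambda>_. S))" and xH: "\<Phi> (insert y B) x \<in> H" for x
    proof -
      have eq: "\<Phi> (insert y B) x = g y (x y) \<oplus>\<^bsub>N\<^esub> \<Phi> B (restrict x B)"
        unfolding \<Phi>_def by (rule copair_insert[OF N const gi \<open>y \<notin> B\<close> x])
      have xB: "restrict x B \<in> carrier (direct_sum B (\<lambda>_. S))"
        using restrict_direct_sum[OF N const gi x] by blast
      have xy: "x y \<in> carrier S" using direct_sumD(1)[OF const x] by blast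
      have gxy: "g y (x y) \<in> carrier N" by (rule mod_homD(1)[OF g(1)[OF y(1)] xy])
      have \<Phi>B: "\<Phi> B (restrict x B) \<in> C" unfolding C_def using xB by blast
      have "\<Phi> B (restrict x B) \<in> D" "g y (x y) \<oplus>\<^bsub>N\<^esub> \<Phi> B (restrict x B) \<in> D"
        using \<Phi>B \<open>C \<subseteq> D\<close> xH[unfolded eq] \<open>H \<subseteq> D\<close> by blast+
      then have "g y (x y) \<in> D"
        by (rule N.submodule_add_cancel[OF D gxy])
      then have x0: "x y = \<zero>\<^bsub>S\<^esub>" using inj xy by blast
      have "\<Phi> B (restrict x B) \<in> carrier N" using \<Phi>B CD(1) by blast
      then have "\<Phi> (insert y B) x = \<Phi> B (restrict x B)"
        unfolding eq x0 mod_hom_zero[OF Sl N g(1)[OF y(1)]] by (rule N.M.l_zero)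
      then have "restrict x B = \<zero>\<^bsub>direct_sum B (\<lambda>_. S)\<^esub>"
        using indep[OF xB] xH by metis
      then have "x i = \<zero>\<^bsub>S\<^esub>" if "i \<in> insert y B" for i
        using that x0 by (auto simp: direct_sum_ops restrict_def fun_eq_iff split: if_splits)
      then show ?thesis
        using direct_sumD(2)[OF const x] by (auto simp: direct_sum_ops extensional_def)
    qed
    then have "insert y B \<in> \<A>" using sub unfolding \<A>_def by blast
    then show False using max \<open>y \<notin> B\<close> by blast
  qed
  then have "carrier N \<subseteq> D"
    using trace_least[OF N D, of S] unfolding gen by blast
  then have "\<exists>u\<in>H. \<exists>x\<in>carrier (direct_sum B (\<lambda>_. S)). y = u \<oplus>\<^bsub>N\<^esub> \<Phi> B x" if "y \<in> carrier N" for y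
    using that unfolding D_def C_def by blast
  then show thesis
    using that \<Phi>[OF BY] indep by blast
qed

text \<open>The projection onto \<open>H\<close> along the complement from \<open>complement_as_direct_sum\<close>.\<close>

lemma submodule_retraction:
  fixes N :: "('r, 'n) module"
  assumes S: "simple_module R S" and N: "left_module R N"
    and gen: "trace R S N = carrier N" and H: "submodule H R N"
  obtains p where "p \<in> mod_hom R N N" "p ` carrier N \<subseteq> H" "\<And>u. u \<in> H \<Longrightarrow> p u = u"
proof -
  have Sl: "left_module R S" using S by (simp add: simple_module_def)
  interpret N: left_module R N by fact
  note HD = N.submoduleD[OF H]
  obtain B :: "'n set" and \<phi> where \<phi>: "\<phi> \<in> mod_hom R (direct_sum B (\<lambda>_. S)) N"
    and indep: "\<And>x. x \<in> carrier (direct_sum B (\<lambda>_. S)) \<Longrightarrow> \<phi> x \<in> H \<Longrightarrow> x = \<zero>\<^bsub>direct_sum B (\<lambda>_. S)\<^esub>"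
    and ex: "\<And>y. y \<in> carrier N \<Longrightarrow>
      \<exists>u\<in>H. \<exists>x\<in>carrier (direct_sum B (\<lambda>_. S)). y = u \<oplus>\<^bsub>N\<^esub> \<phi> x"
    by (rule complement_as_direct_sum[OF assms]) blast
  define D where "D = direct_sum B (\<lambda>_. S)"
  have Dl: "left_module R D"
    unfolding D_def using Sl by (intro direct_sum_left_module N.R.ring_axioms) simp
  interpret D: left_module R D by fact
  note \<phi> = \<phi>[folded D_def] and indep = indep[folded D_def] and ex = ex[folded D_def]
  define p where "p = (\<lambda>y. SOME u. u \<in> H \<and> (\<exists>x\<in>carrier D. y = u \<oplus>\<^bsub>N\<^esub> \<phi> x))"
  have uniq: "u = u'"
    if "u \<in> H" "u' \<in> H" "x \<in> carrier D" "x' \<in> carrier D" "u \<oplus>\<^bsub>N\<^esub> \<phi> x = u' \<oplus>\<^bsub>N\<^esub> \<phi> x'" for u u' x x'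
  proof -
    have c: "u \<in> carrier N" "u' \<in> carrier N" "\<phi> x \<in> carrier N" "\<phi> x' \<in> carrier N"
      using that HD(1) mod_homD(1)[OF \<phi>] by auto
    have "\<phi> x \<ominus>\<^bsub>N\<^esub> \<phi> x' = (\<ominus>\<^bsub>N\<^esub> u \<oplus>\<^bsub>N\<^esub> (u \<oplus>\<^bsub>N\<^esub> \<phi> x)) \<oplus>\<^bsub>N\<^esub> \<ominus>\<^bsub>N\<^esub> \<phi> x'"
      using c by (simp add: N.M.minus_eq N.M.r_neg1)
    also have "\<dots> = \<ominus>\<^bsub>N\<^esub> u \<oplus>\<^bsub>N\<^esub> u'"
      unfolding that(5) using c by (simp add: N.M.a_assoc N.M.r_neg)
    also have "\<dots> \<in> H" using that HD(3,4) by blast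
    finally have "\<phi> (x \<ominus>\<^bsub>D\<^esub> x') \<in> H"
      using mod_hom_minus[OF Dl N \<phi> that(3,4)] by simp
    then have "x = x'"
      using indep[of "x \<ominus>\<^bsub>D\<^esub> x'"] that D.minus_eq_zero_iff by simp
    then show "u = u'" using that(5) c by simp
  qed
  have p: "p (u \<oplus>\<^bsub>N\<^esub> \<phi> x) = u" if "u \<in> H" "x \<in> carrier D" for u x
    unfolding p_def
  proof (rule some_equality)
    show "u \<in> H \<and> (\<exists>x'\<in>carrier D. u \<oplus>\<^bsub>N\<^esub> \<phi> x = u \<oplus>\<^bsub>N\<^esub> \<phi> x')" using that by blast
    show "u' = u" if "u' \<in> H \<and> (\<exists>x'\<in>carrier D. u \<oplus>\<^bsub>N\<^esub> \<phi> x = u' \<oplus>\<^bsub>N\<^esub> \<phi> x')" for u'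
      using that uniq \<open>u \<in> H\<close> \<open>x \<in> carrier D\<close> by metis
  qed
  have pH: "p y \<in> H" if "y \<in> carrier N" for y
    using ex[OF that] p by auto
  have "p \<in> mod_hom R N N"
  proof (rule mod_homI)
    show "p y \<in> carrier N" if "y \<in> carrier N" for y using pH[OF that] HD(1) by blast
  next
    fix y z assume "y \<in> carrier N" "z \<in> carrier N"
    then obtain u x u' x' where y: "u \<in> H" "x \<in> carrier D" "y = u \<oplus>\<^bsub>N\<^esub> \<phi> x"
      and z: "u' \<in> H" "x' \<in> carrier D" "z = u' \<oplus>\<^bsub>N\<^esub> \<phi> x'"
      using ex by metis
    have "y \<oplus>\<^bsub>N\<^esub> z = (u \<oplus>\<^bsub>N\<^esub> u') \<oplus>\<^bsub>N\<^esub> \<phi> (x \<oplus>\<^bsub>D\<^esub> x')"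
      using y z HD(1) mod_homD(1)[OF \<phi>] by (simp add: mod_homD(2)[OF \<phi>] subset_eq N.M.a_ac)
    then show "p (y \<oplus>\<^bsub>N\<^esub> z) = p y \<oplus>\<^bsub>N\<^esub> p z"
      using p y z HD(3) D.M.a_closed by simp
  next
    fix a y assume a: "a \<in> carrier R" and "y \<in> carrier N"
    then obtain u x where y: "u \<in> H" "x \<in> carrier D" "y = u \<oplus>\<^bsub>N\<^esub> \<phi> x"
      using ex by metis
    have "a \<odot>\<^bsub>N\<^esub> y = a \<odot>\<^bsub>N\<^esub> u \<oplus>\<^bsub>N\<^esub> \<phi> (a \<odot>\<^bsub>D\<^esub> x)"
      using y a HD(1) mod_homD(1)[OF \<phi>] by (auto simp: mod_homD(3)[OF \<phi>] subset_eq N.smult_r_distr)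
    then show "p (a \<odot>\<^bsub>N\<^esub> y) = a \<odot>\<^bsub>N\<^esub> p y"
      using p y a HD(5) D.smult_closed by simp
  qed
  moreover have "p u = u" if "u \<in> H" for u
    using p[OF that D.M.zero_closed] mod_hom_zero[OF Dl N \<phi>] HD(1) that by auto
  ultimately show thesis using that pH by blast
qed

section \<open>Modules generated by a simple module\<close>

lemma nonzero_submoduleE:
  assumes "left_module R N" "submodule K R N" "K \<noteq> {\<zero>\<^bsub>N\<^esub>}"
  obtains x where "x \<in> K" "x \<noteq> \<zero>\<^bsub>N\<^esub>"
  using left_module.submoduleD(2)[OF assms(1,2)] assms(3) by blast

text \<open>A non-zero submodule \<open>K\<close> is a retract of \<open>N\<close>, so some homomorphism \<open>S \<rightarrow> N\<close> composed with the retraction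
is a non-zero \<open>g : S \<rightarrow> K\<close>, which is injective. Its image is again a retract of \<open>N\<close>, so every homomorphism
\<open>f : S \<rightarrow> N\<close> extends along \<open>g\<close> to an endomorphism of \<open>N\<close>. If \<open>K\<close> is fully invariant, it follows that \<open>K\<close>
contains the image of \<open>f\<close>.\<close>

lemma endo_simple_if_generated_by_simple:
  assumes S: "simple_module R S" and N: "left_module R N" and gen: "trace R S N = carrier N"
  shows "endo_simple R N"
  unfolding endo_simple_def
proof (intro allI impI)
  have Sl: "left_module R S" using S by (simp add: simple_module_def)
  interpret N: left_module R N by fact
  fix K assume inv: "fully_invariant R N K"
  then have K: "submodule K R N" by (simp add: fully_invariant_def)
  note KD = N.submoduleD[OF K]
  show "K = {\<zero>\<^bsub>N\<^esub>} \<or> K = carrier N"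
  proof (cases "K = {\<zero>\<^bsub>N\<^esub>}")
    case False
    then obtain x where x: "x \<in> K" "x \<noteq> \<zero>\<^bsub>N\<^esub>"
      by (rule nonzero_submoduleE[OF N K])
    obtain p where p: "p \<in> mod_hom R N N" "p ` carrier N \<subseteq> K" "\<And>u. u \<in> K \<Longrightarrow> p u = u"
      by (rule submodule_retraction[OF S N gen K]) blast
    have "\<exists>h s. h \<in> mod_hom R S N \<and> s \<in> carrier S \<and> p (h s) \<noteq> \<zero>\<^bsub>N\<^esub>"
    proof (rule ccontr)
      assume "\<not> ?thesis"
      then have "trace R S N \<subseteq> {y \<in> carrier N. p y \<in> {\<zero>\<^bsub>N\<^esub>}}"
        by (intro trace_least vimage_submodule[OF N N p(1)] N N.zero_submodule)
          (auto intro: mod_homD(1))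
      then have "p x = \<zero>\<^bsub>N\<^esub>" using gen x(1) KD(1) by blast
      then show False using x p(3) by simp
    qed
    then obtain h s1 where h: "h \<in> mod_hom R S N" "s1 \<in> carrier S" "p (h s1) \<noteq> \<zero>\<^bsub>N\<^esub>"
      by blast
    define g where "g = (\<lambda>s. p (h s))"
    have g: "g \<in> mod_hom R S N"
      unfolding g_def by (rule mod_hom_comp[OF h(1) p(1)])
    have gK: "g s \<in> K" if "s \<in> carrier S" for s
      using p(2) mod_homD(1)[OF h(1) that] by (auto simp: g_def)
    have "s = \<zero>\<^bsub>S\<^esub>" if "s \<in> carrier S" "g s = \<zero>\<^bsub>N\<^esub>" for s
      using simple_hom_dichotomy[OF S N g N.zero_submodule] h that by (auto simp: g_def)
    then have inj: "inj_on g (carrier S)"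
      by (rule mod_hom_inj_onI[OF Sl N g])
    define T where "T = N\<lparr>carrier := g ` carrier S\<rparr>"
    have T: "submodule (g ` carrier S) R N"
      by (intro image_submodule[OF Sl N g] left_module.carrier_submodule Sl)
    have Tl: "left_module R T" unfolding T_def by (rule N.submodule_is_left_module[OF T])
    have "g \<in> mod_hom R S T" unfolding T_def by (intro mod_hom_restrict_cod g) simp
    moreover have "bij_betw g (carrier S) (carrier T)"
      using inj by (simp add: bij_betw_def T_def)
    ultimately obtain g' where g': "g' \<in> mod_hom R T S" "\<And>s. s \<in> carrier S \<Longrightarrow> g' (g s) = s"
      by (rule mod_hom_inverse[OF Sl Tl]) blast
    obtain q where q: "q \<in> mod_hom R N N" "q ` carrier N \<subseteq> g ` carrier S"
      "\<And>u. u \<in> g ` carrier S \<Longrightarrow> q u = u"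
      by (rule submodule_retraction[OF S N gen T]) blast
    have qT: "q \<in> mod_hom R N T" unfolding T_def by (intro mod_hom_restrict_cod q)
    have "f s \<in> K" if f: "f \<in> mod_hom R S N" and s: "s \<in> carrier S" for f s
    proof -
      have "(\<lambda>x. f (g' (q x))) \<in> mod_hom R N N"
        by (intro mod_hom_comp[OF mod_hom_comp[OF qT g'(1)] f])
      then have "(\<lambda>x. f (g' (q x))) ` K \<subseteq> K"
        using inv unfolding fully_invariant_def by (rule bspec[OF conjunct2, rotated])
      then have "f (g' (q (g s))) \<in> K"
        using imageI[OF gK[OF s], of "\<lambda>x. f (g' (q x))"] by (rule subsetD)
      then show ?thesis using g'(2)[OF s] q(3) s by simp
    qed
    then have "carrier N \<subseteq> K"
      using trace_least[OF N K, of S] unfolding gen by blast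
    then show ?thesis using KD(1) by blast
  qed simp
qed

text \<open>A submodule is a homomorphic image of \<open>G\<close> under a retraction.\<close>

lemma trace_submodule_of_generated:
  assumes S: "simple_module R S" and G: "left_module R G" and gen: "trace R S G = carrier G"
    and H: "submodule H R G"
  shows "trace R S (G\<lparr>carrier := H\<rparr>) = H"
proof -
  have Sl: "left_module R S" using S by (simp add: simple_module_def)
  have Hl: "left_module R (G\<lparr>carrier := H\<rparr>)"
    by (rule left_module.submodule_is_left_module[OF G H])
  obtain p where p: "p \<in> mod_hom R G G" "p ` carrier G \<subseteq> H" "\<And>u. u \<in> H \<Longrightarrow> p u = u"
    by (rule submodule_retraction[OF S G gen H]) blast
  have "H \<subseteq> p ` carrier G"
    using p(3) left_module.submoduleD(1)[OF G H] by force
  then have "p ` carrier G = carrier (G\<lparr>carrier := H\<rparr>)" using p(2) by auto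
  then show ?thesis
    using trace_image_onto[OF Sl G Hl mod_hom_restrict_cod[OF p(1,2)] _ gen] by simp
qed

lemma sigma_generated_by_simple:
  fixes M :: "('r, 'm) module" and N :: "('r, 'u) module"
  assumes S: "simple_module R S" and M: "left_module R M" and gen: "trace R S M = carrier M"
    and N: "N \<in> sigma R M"
  shows "left_module R N" and "trace R S N = carrier N"
proof -
  show Nl: "left_module R N" using N by (simp add: sigma_def)
  have Sl: "left_module R S" using S by (simp add: simple_module_def)
  have "ring R" using M by (simp add: left_module_def)
  obtain G :: "('r, 'u) module" and H where "is_generated_by R M G" and H: "submodule H R G"
    and "mod_isomorphic R N (G\<lparr>carrier := H\<rparr>)"
    using N by (auto simp: sigma_def)
  then obtain I :: "'u set" and f i where G: "left_module R G"
    and f: "f \<in> mod_hom R (direct_sum I (\<lambda>_. M)) G"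
      "f ` carrier (direct_sum I (\<lambda>_. M)) = carrier G"
    and i: "i \<in> mod_hom R N (G\<lparr>carrier := H\<rparr>)" "bij_betw i (carrier N) (carrier (G\<lparr>carrier := H\<rparr>))"
    unfolding is_generated_by_def mod_isomorphic_def by blast
  have "trace R S (direct_sum I (\<lambda>_. M)) = carrier (direct_sum I (\<lambda>_. M))"
    using M gen by (intro trace_direct_sum[OF Sl]) auto
  then have "trace R S G = carrier G"
    using M by (intro trace_image_onto[OF Sl _ G f] direct_sum_left_module \<open>ring R\<close>) auto
  then have trH: "trace R S (G\<lparr>carrier := H\<rparr>) = carrier (G\<lparr>carrier := H\<rparr>)"
    using trace_submodule_of_generated[OF S G _ H] by simp
  have Hl: "left_module R (G\<lparr>carrier := H\<rparr>)"
    by (rule left_module.submodule_is_left_module[OF G H])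
  obtain j where "j \<in> mod_hom R (G\<lparr>carrier := H\<rparr>) N" "bij_betw j (carrier (G\<lparr>carrier := H\<rparr>)) (carrier N)"
    by (rule mod_hom_inverse[OF Nl Hl i]) blast
  then show "trace R S N = carrier N"
    by (intro trace_image_onto[OF Sl Hl Nl _ _ trH]) (auto simp: bij_betw_def)
qed

text \<open>Any of the summands can serve as \<open>S\<close>, since it is isomorphic to all the others. There is at least
one because \<open>M\<close> is not zero.\<close>

lemma homogeneous_semisimple_imp_generated:
  fixes M :: "('r, 'm) module"
  assumes M: "left_module R M" "nonzero_module M" and hs: "homogeneous_semisimple R M"
  obtains S :: "('r, 'm) module" where "simple_module R S" "trace R S M = carrier M"
proof -
  interpret M: left_module R M by fact
  obtain I :: "'m set" and A :: "'m \<Rightarrow> ('r, 'm) module" where simple: "\<forall>i\<in>I. simple_module R (A i)"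
    and iso: "\<forall>i\<in>I. \<forall>j\<in>I. mod_isomorphic R (A i) (A j)"
    and "mod_isomorphic R M (direct_sum I A)"
    using hs unfolding homogeneous_semisimple_def by blast
  then obtain \<phi> where \<phi>: "\<phi> \<in> mod_hom R M (direct_sum I A)"
    "bij_betw \<phi> (carrier M) (carrier (direct_sum I A))"
    unfolding mod_isomorphic_def by blast
  have A: "\<forall>i\<in>I. left_module R (A i)" using simple by (simp add: simple_module_def)
  have D: "left_module R (direct_sum I A)" by (rule direct_sum_left_module[OF M.R.ring_axioms A])
  have "I \<noteq> {}"
  proof
    assume "I = {}"
    then have "x = y" if "x \<in> carrier (direct_sum I A)" "y \<in> carrier (direct_sum I A)" for x y
      using direct_sumD(2)[OF A that(1)] direct_sumD(2)[OF A that(2)] by simp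
    then have "x = y" if "x \<in> carrier M" "y \<in> carrier M" for x y
      using that mod_homD(1)[OF \<phi>(1)] inj_onD[OF bij_betw_imp_inj_on[OF \<phi>(2)]] by blast
    then have "carrier M = {\<zero>\<^bsub>M\<^esub>}" using M.M.zero_closed by blast
    then show False using M(2) by (simp add: nonzero_module_def)
  qed
  then obtain i where i: "i \<in> I" by blast
  have Si: "simple_module R (A i)" and Sl: "left_module R (A i)" using simple A i by auto
  have "trace R (A i) (A j) = carrier (A j)" if "j \<in> I" for j
  proof -
    have "mod_isomorphic R (A i) (A j)" using iso i that by blast
    then obtain \<psi> where \<psi>: "\<psi> \<in> mod_hom R (A i) (A j)" "\<psi> ` carrier (A i) = carrier (A j)"
      unfolding mod_isomorphic_def bij_betw_def by blast
    have Aj: "left_module R (A j)" using A that by blast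
    have "carrier (A j) \<subseteq> trace R (A i) (A j)"
      unfolding \<psi>(2)[symmetric] using hom_image_in_trace[OF Aj \<psi>(1)] by blast
    then show ?thesis
      using left_module.submoduleD(1)[OF Aj trace_submodule[OF Sl Aj]] by blast
  qed
  then have trD: "trace R (A i) (direct_sum I A) = carrier (direct_sum I A)"
    by (intro trace_direct_sum[OF Sl A])
  obtain j where "j \<in> mod_hom R (direct_sum I A) M" "bij_betw j (carrier (direct_sum I A)) (carrier M)"
    by (rule mod_hom_inverse[OF M(1) D \<phi>]) blast
  then have "trace R (A i) M = carrier M"
    by (intro trace_image_onto[OF Sl D M(1) _ _ trD]) (auto simp: bij_betw_def)
  then show thesis using that Si by blast
qed

text \<open>A complement of \<open>0\<close> is an isomorphic copy of \<open>M\<close>.\<close>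

lemma generated_imp_homogeneous_semisimple:
  fixes M S :: "('r, 'm) module"
  assumes S: "simple_module R S" and M: "left_module R M" and gen: "trace R S M = carrier M"
  shows "homogeneous_semisimple R M"
proof -
  interpret M: left_module R M by fact
  have Sl: "left_module R S" using S by (simp add: simple_module_def)
  obtain B :: "'m set" and \<phi> where \<phi>: "\<phi> \<in> mod_hom R (direct_sum B (\<lambda>_. S)) M"
    and ker: "\<And>x. x \<in> carrier (direct_sum B (\<lambda>_. S)) \<Longrightarrow> \<phi> x \<in> {\<zero>\<^bsub>M\<^esub>} \<Longrightarrow>
      x = \<zero>\<^bsub>direct_sum B (\<lambda>_. S)\<^esub>"
    and onto: "\<And>y. y \<in> carrier M \<Longrightarrow>
      \<exists>u\<in>{\<zero>\<^bsub>M\<^esub>}. \<exists>x\<in>carrier (direct_sum B (\<lambda>_. S)). y = u \<oplus>\<^bsub>M\<^esub> \<phi> x"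
    by (rule complement_as_direct_sum[OF S M gen M.zero_submodule]) blast
  have D: "left_module R (direct_sum B (\<lambda>_. S))"
    using Sl by (intro direct_sum_left_module M.R.ring_axioms) simp
  have "inj_on \<phi> (carrier (direct_sum B (\<lambda>_. S)))"
    using ker by (intro mod_hom_inj_onI[OF D M \<phi>]) simp
  moreover have "\<phi> ` carrier (direct_sum B (\<lambda>_. S)) = carrier M"
  proof
    show "\<phi> ` carrier (direct_sum B (\<lambda>_. S)) \<subseteq> carrier M"
      using mod_homD(1)[OF \<phi>] by blast
    show "carrier M \<subseteq> \<phi> ` carrier (direct_sum B (\<lambda>_. S))"
      using onto mod_homD(1)[OF \<phi>] by fastforce
  qed
  ultimately have "bij_betw \<phi> (carrier (direct_sum B (\<lambda>_. S))) (carrier M)"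
    by (simp add: bij_betw_def)
  then obtain g where "g \<in> mod_hom R M (direct_sum B (\<lambda>_. S))"
    "bij_betw g (carrier M) (carrier (direct_sum B (\<lambda>_. S)))"
    by (rule mod_hom_inverse[OF D M \<phi>]) blast
  then have "mod_isomorphic R M (direct_sum B (\<lambda>_. S))"
    unfolding mod_isomorphic_def by blast
  moreover have "mod_isomorphic R S S"
    unfolding mod_isomorphic_def by (rule bexI[OF _ mod_hom_id]) (simp add: bij_betw_def)
  ultimately show ?thesis
    using S unfolding homogeneous_semisimple_def by (intro exI[of _ B] exI[of _ "\<lambda>_. S"]) simp
qed

section \<open>A test module in \<open>\<sigma>[M]\<close>\<close>

text \<open>Take a cyclic submodule \<open>U\<close> with generator \<open>x0 \<noteq> 0\<close> and a submodule \<open>P\<close> of \<open>U\<close> that is maximal among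
those avoiding \<open>x0\<close>. A larger submodule of \<open>U\<close> contains \<open>x0\<close> and hence equals \<open>U\<close>, so \<open>U/P\<close> is simple.\<close>

lemma simple_subquotient:
  fixes M :: "('r, 'm) module"
  assumes M: "left_module R M" and nz: "nonzero_module M"
  obtains U and S :: "('r, 'm) module" and \<pi> where "submodule U R M" "simple_module R S"
    "\<pi> \<in> mod_hom R (M\<lparr>carrier := U\<rparr>) S" "\<pi> ` U = carrier S"
proof -
  interpret M: left_module R M by fact
  obtain x0 where x0: "x0 \<in> carrier M" "x0 \<noteq> \<zero>\<^bsub>M\<^esub>"
    using nz M.M.zero_closed unfolding nonzero_module_def by blast
  define U where "U = (\<lambda>a. a \<odot>\<^bsub>M\<^esub> x0) ` carrier R"
  have U: "submodule U R M" unfolding U_def by (rule M.cyclic_submodule[OF x0(1)])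
  have "x0 \<in> U"
    using M.smult_one[OF x0(1)] unfolding U_def by (metis M.R.one_closed image_eqI)
  have U_least: "U \<subseteq> K" if "submodule K R M" "x0 \<in> K" for K
    using M.submoduleD(5)[OF that(1) _ that(2)] unfolding U_def by blast
  define \<A> where "\<A> = {P. submodule P R M \<and> P \<subseteq> U \<and> x0 \<notin> P}"
  have "\<exists>P\<in>\<A>. \<forall>X\<in>\<A>. P \<subseteq> X \<longrightarrow> X = P"
  proof (rule subset_Zorn_nonempty)
    have "{\<zero>\<^bsub>M\<^esub>} \<in> \<A>"
      using M.zero_submodule M.submoduleD(2)[OF U] x0(2) unfolding \<A>_def by blast
    then show "\<A> \<noteq> {}" by blast
  next
    fix \<C> assume ne: "\<C> \<noteq> {}" and chain: "subset.chain \<A> \<C>"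
    have sub: "submodule P R M" "P \<subseteq> U" "x0 \<notin> P" if "P \<in> \<C>" for P
      using chain that by (auto simp: subset.chain_def \<A>_def)
    have "submodule (\<Union>\<C>) R M"
    proof (rule M.submoduleI)
      show "\<Union>\<C> \<subseteq> carrier M" using M.submoduleD(1)[OF sub(1)] by blast
      show "\<zero>\<^bsub>M\<^esub> \<in> \<Union>\<C>" using ne M.submoduleD(2)[OF sub(1)] by blast
      show "x \<oplus>\<^bsub>M\<^esub> y \<in> \<Union>\<C>" if xy: "x \<in> \<Union>\<C>" "y \<in> \<Union>\<C>" for x y
      proof -
        obtain P Q where PQ: "P \<in> \<C>" "x \<in> P" "Q \<in> \<C>" "y \<in> Q" using xy by blast
        then have "P \<subseteq> Q \<or> Q \<subseteq> P" using chain by (auto simp: subset.chain_def)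
        then obtain P' where "P' \<in> \<C>" "x \<in> P'" "y \<in> P'" using PQ by blast
        then show ?thesis using M.submoduleD(3)[OF sub(1)] by blast
      qed
      show "a \<odot>\<^bsub>M\<^esub> x \<in> \<Union>\<C>" if "a \<in> carrier R" "x \<in> \<Union>\<C>" for a x
        using that M.submoduleD(5)[OF sub(1)] by blast
    qed
    then show "\<Union>\<C> \<in> \<A>" using sub unfolding \<A>_def by blast
  qed
  then obtain P where "P \<in> \<A>" and P_max: "\<forall>X\<in>\<A>. P \<subseteq> X \<longrightarrow> X = P" by blast
  then have P: "submodule P R M" "P \<subseteq> U" "x0 \<notin> P" by (simp_all add: \<A>_def)
  have max: "X = P" if "submodule X R M" "X \<subseteq> U" "x0 \<notin> X" "P \<subseteq> X" for X
  proof -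
    have "X \<in> \<A>" using that by (simp add: \<A>_def)
    then show ?thesis using P_max that(4) by blast
  qed
  define N where "N = M\<lparr>carrier := U\<rparr>"
  have cN: "carrier N = U" by (simp add: N_def)
  have N: "left_module R N" unfolding N_def by (rule M.submodule_is_left_module[OF U])
  have PN: "submodule P R N"
    using submodule_of_submodule[OF M U] P unfolding N_def by blast
  have "carrier N \<lesssim> (UNIV :: 'm set)" by (rule subset_imp_lepoll) simp
  then obtain S :: "('r, 'm) module" and \<pi> where Sl: "left_module R S"
    and \<pi>: "\<pi> \<in> mod_hom R N S" "\<pi> ` carrier N = carrier S"
    and ker: "\<And>x. x \<in> carrier N \<Longrightarrow> \<pi> x = \<zero>\<^bsub>S\<^esub> \<longleftrightarrow> x \<in> P"
    by (rule quotient_in_universe[OF N PN]) blast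
  have "\<pi> x0 \<in> carrier S" "\<pi> x0 \<noteq> \<zero>\<^bsub>S\<^esub>"
    using mod_homD(1)[OF \<pi>(1)] ker \<open>x0 \<in> U\<close> P(3) by (auto simp: cN)
  then have "nonzero_module S" unfolding nonzero_module_def by blast
  moreover have "K = {\<zero>\<^bsub>S\<^esub>} \<or> K = carrier S" if K: "submodule K R S" for K
  proof -
    note KD = left_module.submoduleD[OF Sl K]
    define L where "L = {x \<in> carrier N. \<pi> x \<in> K}"
    have "submodule L R N"
      unfolding L_def by (rule vimage_submodule[OF N Sl \<pi>(1) K])
    then have L: "submodule L R M" "L \<subseteq> U"
      using submodule_of_submodule[OF M U, of L] unfolding N_def by auto
    have KL: "K = \<pi> ` L"
      using KD(1) unfolding \<pi>(2)[symmetric] L_def by blast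
    have PL: "P \<subseteq> L"
    proof
      fix x assume x: "x \<in> P"
      then have "x \<in> carrier N" using P(2) cN by blast
      moreover from this have "\<pi> x = \<zero>\<^bsub>S\<^esub>" using ker x by blast
      ultimately show "x \<in> L" using KD(2) unfolding L_def by simp
    qed
    show ?thesis
    proof (cases "x0 \<in> L")
      case True
      then have "L = carrier N" using U_least[OF L(1)] L(2) cN by blast
      then show ?thesis using KL \<pi>(2) by simp
    next
      case False
      then have "L = P" using max[OF L _ PL] by blast
      then have "x = \<zero>\<^bsub>S\<^esub>" if "x \<in> K" for x
        using that ker P(2) unfolding KL by (auto simp: cN)
      then show ?thesis using KD(2) by blast
    qed
  qed
  ultimately have "simple_module R S"
    using Sl unfolding simple_module_def by blast
  then show thesis
    using that U \<pi> unfolding N_def by simp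
qed

text \<open>The module \<open>L\<close> is \<open>M \<oplus> S \<oplus> M/T\<close>, where \<open>S\<close> is the quotient of \<open>U\<close> by the kernel of \<open>\<pi>\<close>. It is obtained
from \<open>D = M \<oplus> M \<oplus> M\<close> by dividing out \<open>W = 0 \<oplus> ker \<pi> \<oplus> T\<close> and restricting to the image of
\<open>V = M \<oplus> U \<oplus> M\<close>, which makes it a submodule of a module generated by \<open>M\<close>. The maps \<open>p1\<close>, \<open>j1\<close>, \<open>p2\<close>, \<open>j2\<close>
are the projections to and injections of the first two summands, and \<open>j3\<close> is the canonical map from \<open>M\<close>
to the third.\<close>

lemma sigma_contains_test_module:
  fixes M :: "('r, 'm) module" and S :: "('r, 's) module"
  assumes M: "left_module R M" and S: "left_module R S" and U: "submodule U R M"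
    and \<pi>: "\<pi> \<in> mod_hom R (M\<lparr>carrier := U\<rparr>) S" "\<pi> ` U = carrier S"
    and T: "submodule T R M"
    and inf: "infinite (UNIV :: 'u set)" and small: "carrier M \<lesssim> (UNIV :: 'u set)"
  obtains L :: "('r, 'u) module" and p1 j1 p2 j2 j3 where "L \<in> sigma R M" "left_module R L"
    "p1 \<in> mod_hom R L M" "j1 \<in> mod_hom R M L" "\<And>m. m \<in> carrier M \<Longrightarrow> p1 (j1 m) = m"
    "p2 \<in> mod_hom R L S" "j2 \<in> mod_hom R S L" "\<And>s. s \<in> carrier S \<Longrightarrow> p2 (j2 s) = s"
    "j3 \<in> mod_hom R M L" "\<And>m. m \<in> carrier M \<Longrightarrow> j3 m = \<zero>\<^bsub>L\<^esub> \<longleftrightarrow> m \<in> T"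
proof -
  interpret M: left_module R M by fact
  note UD = M.submoduleD[OF U] and TD = M.submoduleD[OF T]
  obtain I :: "'u set" where "card I = 3"
    using infinite_arbitrarily_large[OF inf] by blast
  then obtain a b c where I: "I = {a, b, c}" and ne: "a \<noteq> b" "a \<noteq> c" "b \<noteq> c"
    by (auto simp: card_3_iff)
  have const: "\<forall>i\<in>I. left_module R ((\<lambda>_. M) i)" using M by simp
  define D where "D = direct_sum I (\<lambda>_. M)"
  have D: "left_module R D" unfolding D_def by (rule direct_sum_left_module[OF M.R.ring_axioms const])
  interpret D: left_module R D by fact
  have proj: "(\<lambda>x. x i) \<in> mod_hom R D M" if "i \<in> I" for i
    using dsum_proj_hom[OF const that] by (simp add: D_def)
  define in' where "in' = dsum_in I (\<lambda>_. M)"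
  have in': "in' i \<in> mod_hom R M D" if "i \<in> I" for i
    using dsum_in_hom[OF const that] by (simp add: D_def in'_def)
  have in'_app: "in' i m j = (if j = i then m else \<zero>\<^bsub>M\<^esub>)" if "j \<in> I" for i j m
    using that by (simp add: in'_def dsum_in_def)
  define V where "V = {x \<in> carrier D. x b \<in> U}"
  have V: "submodule V R D"
    unfolding V_def using I by (intro vimage_submodule[OF D M proj U]) simp
  define N where "N = M\<lparr>carrier := U\<rparr>"
  have N: "left_module R N" unfolding N_def by (rule M.submodule_is_left_module[OF U])
  have VN: "(\<lambda>x. x b) \<in> mod_hom R (D\<lparr>carrier := V\<rparr>) N"
    unfolding N_def using I D.submoduleD(1)[OF V]
    by (intro mod_hom_restrict_cod mod_hom_restrict_dom proj) (auto simp: V_def)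
  have Vl: "left_module R (D\<lparr>carrier := V\<rparr>)" by (rule D.submodule_is_left_module[OF V])
  have \<pi>N: "\<pi> \<in> mod_hom R N S" using \<pi> by (simp add: N_def)
  have V\<pi>: "(\<lambda>x. \<pi> (x b)) \<in> mod_hom R (D\<lparr>carrier := V\<rparr>) S"
    by (rule mod_hom_comp[OF VN \<pi>N])
  have Va: "(\<lambda>x. x a) \<in> mod_hom R (D\<lparr>carrier := V\<rparr>) M"
    using I D.submoduleD(1)[OF V] by (intro mod_hom_restrict_dom proj) auto
  define W where "W = {x \<in> V. x a = \<zero>\<^bsub>M\<^esub> \<and> \<pi> (x b) = \<zero>\<^bsub>S\<^esub> \<and> x c \<in> T}"
  have "submodule W R (D\<lparr>carrier := V\<rparr>)"
  proof -
    have Vc: "(\<lambda>x. x c) \<in> mod_hom R (D\<lparr>carrier := V\<rparr>) M"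
      using I D.submoduleD(1)[OF V] by (intro mod_hom_restrict_dom proj) auto
    have 1: "submodule {x \<in> V. x a = \<zero>\<^bsub>M\<^esub>} R (D\<lparr>carrier := V\<rparr>)"
      using vimage_submodule[OF Vl M Va M.zero_submodule] by simp
    have 2: "submodule {x \<in> V. \<pi> (x b) = \<zero>\<^bsub>S\<^esub>} R (D\<lparr>carrier := V\<rparr>)"
      using vimage_submodule[OF Vl S V\<pi> left_module.zero_submodule[OF S]] by simp
    have 3: "submodule {x \<in> V. x c \<in> T} R (D\<lparr>carrier := V\<rparr>)"
      using vimage_submodule[OF Vl M Vc T] by simp
    have "W = {x \<in> V. x a = \<zero>\<^bsub>M\<^esub>} \<inter> ({x \<in> V. \<pi> (x b) = \<zero>\<^bsub>S\<^esub>} \<inter> {x \<in> V. x c \<in> T})"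
      unfolding W_def by blast
    then show ?thesis
      using left_module.Int_submodule[OF Vl 1 left_module.Int_submodule[OF Vl 2 3]] by simp
  qed
  then have W: "submodule W R D" using submodule_of_submodule[OF D V] by blast
  have "carrier D \<lesssim> (UNIV :: 'u set)"
  proof -
    obtain e :: "'m \<Rightarrow> 'u" where e: "inj_on e (carrier M)"
      using small unfolding lepoll_def by blast
    \<comment> \<open>An infinite type is equipotent with its square, so triples of its elements can be coded in it.\<close>
    obtain t :: "'u \<times> 'u \<Rightarrow> 'u" where t: "inj t"
      using iffD2[OF card_of_ordIso card_of_Times_same_infinite[OF inf]]
      by (auto simp: bij_betw_def)
    have "inj_on (\<lambda>x. t (e (x a), t (e (x b), e (x c)))) (carrier D)"
    proof (rule inj_onI)
      fix x y assume x: "x \<in> carrier D" and y: "y \<in> carrier D"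
        and eq: "t (e (x a), t (e (x b), e (x c))) = t (e (y a), t (e (y b), e (y c)))"
      have "e (x i) = e (y i)" if "i \<in> I" for i
        using eq that by (auto simp: inj_eq[OF t] I)
      then have "x i = y i" if "i \<in> I" for i
        using inj_onD[OF e] mod_homD(1)[OF proj[OF that]] x y that by blast
      then show "x = y"
        using direct_sumD(2)[OF const] x y unfolding D_def by (auto intro: extensionalityI)
    qed
    then show ?thesis unfolding lepoll_def by blast
  qed
  then obtain G :: "('r, 'u) module" and q where G: "left_module R G"
    and q: "q \<in> mod_hom R D G" "q ` carrier D = carrier G"
    and ker: "\<And>x. x \<in> carrier D \<Longrightarrow> q x = \<zero>\<^bsub>G\<^esub> \<longleftrightarrow> x \<in> W"
    by (rule quotient_in_universe[OF D W]) blast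
  have H: "submodule (q ` V) R G" by (rule image_submodule[OF D G q(1) V])
  define L where "L = G\<lparr>carrier := q ` V\<rparr>"
  have L: "left_module R L" unfolding L_def by (rule left_module.submodule_is_left_module[OF G H])
  have zeroL: "\<zero>\<^bsub>L\<^esub> = \<zero>\<^bsub>G\<^esub>" by (simp add: L_def)
  have "is_generated_by R M G"
    unfolding is_generated_by_def using G q unfolding D_def by blast
  moreover have "mod_isomorphic R L (G\<lparr>carrier := q ` V\<rparr>)"
    unfolding mod_isomorphic_def L_def by (rule bexI[OF _ mod_hom_id]) (simp add: bij_betw_def)
  ultimately have sig: "L \<in> sigma R M"
    unfolding sigma_def using L H by blast
  have qV: "q \<in> mod_hom R (D\<lparr>carrier := V\<rparr>) L"
    unfolding L_def using D.submoduleD(1)[OF V]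
    by (intro mod_hom_restrict_cod mod_hom_restrict_dom q) auto
  have ontoV: "q ` carrier (D\<lparr>carrier := V\<rparr>) = carrier L" by (simp add: L_def)
  have kerV: "q x = \<zero>\<^bsub>L\<^esub> \<longleftrightarrow> x \<in> W" if "x \<in> V" for x
    using that ker unfolding zeroL V_def by blast
  obtain p1 where p1: "p1 \<in> mod_hom R L M" "\<And>x. x \<in> V \<Longrightarrow> p1 (q x) = x a"
    by (rule mod_hom_factor[OF Vl L M qV ontoV Va]) (auto simp: kerV W_def)
  obtain p2 where p2: "p2 \<in> mod_hom R L S" "\<And>x. x \<in> V \<Longrightarrow> p2 (q x) = \<pi> (x b)"
    by (rule mod_hom_factor[OF Vl L S qV ontoV V\<pi>]) (auto simp: kerV W_def)
  have inV: "in' i \<in> mod_hom R M (D\<lparr>carrier := V\<rparr>)" if "i \<in> {a, c}" for i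
    using that UD(2) I ne mod_homD(1)[OF in']
    by (intro mod_hom_restrict_cod in') (auto simp: V_def in'_app)
  have inVb: "in' b \<in> mod_hom R N (D\<lparr>carrier := V\<rparr>)"
    unfolding N_def using UD(1) I mod_homD(1)[OF in']
    by (intro mod_hom_restrict_cod mod_hom_restrict_dom in') (auto simp: V_def in'_app)
  have \<pi>0: "\<pi> \<zero>\<^bsub>M\<^esub> = \<zero>\<^bsub>S\<^esub>" using mod_hom_zero[OF N S \<pi>N] by (simp add: N_def)
  have inb: "in' b n \<in> V" if "n \<in> U" for n
    using mod_homD(1)[OF inVb] that by (simp add: N_def)
  have "\<pi> ` carrier N = carrier S" using \<pi>(2) by (simp add: N_def)
  then obtain j2 where j2: "j2 \<in> mod_hom R S L" "\<And>n. n \<in> U \<Longrightarrow> j2 (\<pi> n) = q (in' b n)"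
    by (rule mod_hom_factor[OF N S L \<pi>N _ mod_hom_comp[OF inVb qV]])
      (use inb ne I TD(2) in \<open>auto simp: kerV W_def in'_app N_def\<close>)
  have "p2 (j2 s) = s" if "s \<in> carrier S" for s
  proof -
    have "s \<in> \<pi> ` U" using that \<pi>(2) by simp
    then obtain n where n: "n \<in> U" "s = \<pi> n" by blast
    then show ?thesis using j2(2) p2(2) inb I by (simp add: in'_app)
  qed
  moreover have "p1 (q (in' a m)) = m" if "m \<in> carrier M" for m
    using p1(2) mod_homD(1)[OF inV, of a m] that I by (simp add: in'_app)
  moreover have "q (in' c m) = \<zero>\<^bsub>L\<^esub> \<longleftrightarrow> m \<in> T" if "m \<in> carrier M" for m
    using mod_homD(1)[OF inV, of c m] that kerV I ne \<pi>0 by (simp add: W_def in'_app)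
  moreover have "(\<lambda>m. q (in' i m)) \<in> mod_hom R M L" if "i \<in> {a, c}" for i
    by (rule mod_hom_comp[OF inV[OF that] qV])
  ultimately show thesis
    using that[OF sig L p1(1) _ _ p2(1) j2(1), of "\<lambda>m. q (in' a m)" "\<lambda>m. q (in' c m)"] by blast
qed

text \<open>Only the test module \<open>L = M \<oplus> S \<oplus> M/T\<close> is used, with \<open>T\<close> the trace of \<open>S\<close> in \<open>M\<close>. Homomorphisms preserve
traces, so the first projection maps the trace \<open>K\<close> of \<open>S\<close> in \<open>L\<close> into \<open>T\<close>. Hence \<open>j3 \<circ> p1\<close> kills \<open>K\<close>, while
\<open>j2 \<circ> p2\<close> maps \<open>L\<close> into \<open>K\<close>.\<close>

lemma trace_full_if_sigma_endo_prime_or_coprime: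
  fixes M :: "('r, 'm) module"
  assumes M: "left_module R M" and S: "simple_module R S" and U: "submodule U R M"
    and \<pi>: "\<pi> \<in> mod_hom R (M\<lparr>carrier := U\<rparr>) S" "\<pi> ` U = carrier S"
    and inf: "infinite (UNIV :: 'u set)" and small: "carrier M \<lesssim> (UNIV :: 'u set)"
    and endo: "\<And>N :: ('r, 'u) module. N \<in> sigma R M \<Longrightarrow> nonzero_module N \<Longrightarrow>
      endo_prime R N \<or> endo_coprime R N"
  shows "trace R S M = carrier M"
proof -
  interpret M: left_module R M by fact
  have Sl: "left_module R S" using S by (simp add: simple_module_def)
  interpret S: left_module R S by fact
  have T: "submodule (trace R S M) R M" by (rule trace_submodule[OF Sl M])
  obtain L :: "('r, 'u) module" and p1 j1 p2 j2 j3 where sig: "L \<in> sigma R M"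
    and L: "left_module R L"
    and p1: "p1 \<in> mod_hom R L M" and j1: "j1 \<in> mod_hom R M L"
    and p1j1: "\<And>m. m \<in> carrier M \<Longrightarrow> p1 (j1 m) = m"
    and p2: "p2 \<in> mod_hom R L S" and j2: "j2 \<in> mod_hom R S L"
    and p2j2: "\<And>s. s \<in> carrier S \<Longrightarrow> p2 (j2 s) = s"
    and j3: "j3 \<in> mod_hom R M L"
    and j3_ker: "\<And>m. m \<in> carrier M \<Longrightarrow> j3 m = \<zero>\<^bsub>L\<^esub> \<longleftrightarrow> m \<in> trace R S M"
    by (rule sigma_contains_test_module[OF M Sl U \<pi> T inf small]) blast
  define K where "K = trace R S L"
  have K: "fully_invariant R L K" unfolding K_def by (rule trace_fully_invariant[OF Sl L])
  have "carrier S \<noteq> {\<zero>\<^bsub>S\<^esub>}" using S by (simp add: simple_module_def nonzero_module_def)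
  then obtain s where s: "s \<in> carrier S" "s \<noteq> \<zero>\<^bsub>S\<^esub>" using S.M.zero_closed by blast
  have j2s: "j2 s \<in> carrier L" "j2 s \<in> K" "j2 s \<noteq> \<zero>\<^bsub>L\<^esub>"
    using mod_homD(1)[OF j2 s(1)] hom_image_in_trace[OF L j2 s(1)] p2j2[OF s(1)] s(2)
      mod_hom_zero[OF L Sl p2] by (auto simp: K_def)
  have p1K: "p1 x \<in> trace R S M" if "x \<in> K" for x
    using mod_hom_trace[OF Sl L M p1] that unfolding K_def by blast
  have "nonzero_module L" using j2s unfolding nonzero_module_def by blast
  then have "endo_prime R L \<or> endo_coprime R L" using endo sig by blast
  then have "m \<in> trace R S M" if m: "m \<in> carrier M" for m
  proof
    \<comment> \<open>\<open>j3 \<circ> p1\<close> is zero, and \<open>j3\<close> has kernel \<open>T\<close>.\<close>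
    assume prime: "endo_prime R L"
    have "(\<lambda>x. j3 (p1 x)) \<in> mod_hom R L L" by (rule mod_hom_comp[OF p1 j3])
    moreover have "\<forall>x\<in>K. j3 (p1 x) = \<zero>\<^bsub>L\<^esub>"
    proof
      fix x assume "x \<in> K"
      then have "p1 x \<in> trace R S M" by (rule p1K)
      then show "j3 (p1 x) = \<zero>\<^bsub>L\<^esub>" using j3_ker M.submoduleD(1)[OF T] by blast
    qed
    moreover have "K \<noteq> {\<zero>\<^bsub>L\<^esub>}" using j2s by blast
    ultimately have "\<forall>x\<in>carrier L. j3 (p1 x) = \<zero>\<^bsub>L\<^esub>"
      using prime K unfolding endo_prime_def by (metis (no_types, lifting))
    then have "j3 m = \<zero>\<^bsub>L\<^esub>"
      using mod_homD(1)[OF j1 m] p1j1[OF m] by force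
    then show ?thesis using j3_ker[OF m] by simp
  next
    \<comment> \<open>\<open>j2 \<circ> p2\<close> is not zero, which forces \<open>K = L\<close>.\<close>
    assume coprime: "endo_coprime R L"
    have "(\<lambda>x. j2 (p2 x)) \<in> mod_hom R L L" by (rule mod_hom_comp[OF p2 j2])
    moreover have "(\<lambda>x. j2 (p2 x)) ` carrier L \<subseteq> K"
      unfolding K_def using hom_image_in_trace[OF L j2] mod_homD(1)[OF p2] by blast
    moreover have "j2 (p2 (j2 s)) \<noteq> \<zero>\<^bsub>L\<^esub>" using j2s(3) p2j2[OF s(1)] by simp
    ultimately have "K = carrier L"
      using coprime K j2s(1) unfolding endo_coprime_def by (metis (no_types, lifting))
    then have "j1 m \<in> K" using mod_homD(1)[OF j1 m] by simp
    then show ?thesis using p1K p1j1[OF m] by force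
  qed
  then show ?thesis using M.submoduleD(1)[OF T] by blast
qed

lemma endo_simple_imp_endo_prime: "endo_simple R N \<Longrightarrow> endo_prime R N"
  unfolding endo_simple_def endo_prime_def by metis

lemma endo_simple_imp_endo_coprime: "endo_simple R N \<Longrightarrow> endo_coprime R N"
  unfolding endo_simple_def endo_coprime_def by blast

theorem proposition2p19:
  fixes R :: "('r, 'x) ring_scheme" and M :: "('r, 'm) module"
  assumes "ring R" and "\<one>\<^bsub>R\<^esub> \<noteq> \<zero>\<^bsub>R\<^esub>"
    and "left_module R M" and "nonzero_module M"
    and "infinite (UNIV :: 'u set)" and "carrier M \<lesssim> (UNIV :: 'u set)"
  shows "(homogeneous_semisimple R M \<longleftrightarrow>
            (\<forall>N \<in> (sigma R M :: ('r, 'u) module set). nonzero_module N \<longrightarrow> endo_prime R N)) \<and>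
         (homogeneous_semisimple R M \<longleftrightarrow>
            (\<forall>N \<in> (sigma R M :: ('r, 'u) module set). nonzero_module N \<longrightarrow> endo_coprime R N)) \<and>
         (homogeneous_semisimple R M \<longleftrightarrow>
            (\<forall>N \<in> (sigma R M :: ('r, 'u) module set). nonzero_module N \<longrightarrow> endo_simple R N))"
proof -
  have simple: "endo_simple R N"
    if hs: "homogeneous_semisimple R M" and N: "N \<in> sigma R M" for N :: "('r, 'u) module"
  proof -
    obtain S :: "('r, 'm) module" where S: "simple_module R S" "trace R S M = carrier M"
      by (rule homogeneous_semisimple_imp_generated[OF assms(3,4) hs])
    show ?thesis
      using endo_simple_if_generated_by_simple[OF S(1)]
        sigma_generated_by_simple[OF S(1) assms(3) S(2) N] by blast
  qed
  have hs: "homogeneous_semisimple R M"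
    if endo: "\<And>N :: ('r, 'u) module. N \<in> sigma R M \<Longrightarrow> nonzero_module N \<Longrightarrow>
      endo_prime R N \<or> endo_coprime R N"
  proof -
    obtain U and S :: "('r, 'm) module" and \<pi> where U: "submodule U R M" and S: "simple_module R S"
      and \<pi>: "\<pi> \<in> mod_hom R (M\<lparr>carrier := U\<rparr>) S" "\<pi> ` U = carrier S"
      by (rule simple_subquotient[OF assms(3,4)])
    have "trace R S M = carrier M"
      by (rule trace_full_if_sigma_endo_prime_or_coprime[OF assms(3) S U \<pi> assms(5,6) endo])
    then show ?thesis
      by (rule generated_imp_homogeneous_semisimple[OF S assms(3)])
  qed
  show ?thesis
  proof (intro conjI iffI ballI impI)
    show "homogeneous_semisimple R M"
      if "\<forall>N \<in> (sigma R M :: ('r, 'u) module set). nonzero_module N \<longrightarrow> endo_prime R N"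
      using hs that by blast
    show "homogeneous_semisimple R M"
      if "\<forall>N \<in> (sigma R M :: ('r, 'u) module set). nonzero_module N \<longrightarrow> endo_coprime R N"
      using hs that by blast
    show "homogeneous_semisimple R M"
      if "\<forall>N \<in> (sigma R M :: ('r, 'u) module set). nonzero_module N \<longrightarrow> endo_simple R N"
      by (rule hs) (use that endo_simple_imp_endo_prime in blast)
  qed (auto intro: simple endo_simple_imp_endo_prime endo_simple_imp_endo_coprime)
qed

end
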